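(* Let $f\in K((x))[y]$ be a monic reduced polynomial and let $P_i^M=\{F_1,\dots,F_r\}$ be a point of $\mathrm{Top}(f)$, with $n_{F_1}=\max_{1\le k\le r}n_{F_k}$. Then: (i) If $(F_1,\dots,F_r)$ is equivalent with $M>m_{h_{F_1}}^{F_1}/n_{F_1}$, then $\deg_yQ_{f_y}(M,i)=(r-1)n_{F_1}$. (ii) If $(F_1,\dots,F_r)$ is equivalent with $M=m_{h_{F_1}}^{F_1}/n_{F_1}$, then $\deg_yQ_{f_y}(M,i)=(r-1)n_{F_1}+(e_{h_{F_1}}^{F_1}-1)\dfrac{n_{F_1}}{d_{h_{F_1}}^{F_1}}$. (iii) If $(F_1,\dots,F_r)$ is almost equivalent, then $\deg_yQ_{f_y}(M,i)=(r-1)n_{F_1}$.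
   Context: $K$ is an algebraically closed field of characteristic $0$. $O_x$ denotes the order in $x$ of a series in $K((x^{1/p}))$. $f_y$ is the $y$-derivative of $f$; "irreducible components" are the monic irreducible factors in $K((x))[y]$. Characteristic sequences. Let $F\in K((x))[y]$ be monic irreducible of degree $n_F$ in $y$. By Newton's theorem its roots are $y(w^kx^{1/n_F})$, $1\le k\le n_F$, where $w$ is a primitive $n_F$-th root of unity and $y(t)=\sum a_it^i\in K((t))$ satisfies $F(t^{n_F},y(t))=0$; $\mathrm{supp}(F)=\{i:a_i\ne0\}$. Put $d_1^F=n_F$ and for $k\ge1$, while $d_k^F>1$, $m_k^F=\inf\{i\in\mathrm{supp}(F): d_k^F\nmid i\}$, $d_{k+1}^F=\gcd(d_k^F,m_k^F)$; $h_F$ is the integer with $d_{h_F+1}^F=1$ first attained ($h_F=0$ if $n_F=1$), and $m_{h_F+1}^F=+\infty$. Put $e_k^F=d_k^F/d_{k+1}^F$ for $1\le k\le h_F$. If $h_F=0$, conditions $M>m_{h_F}^F/n_F$ or $c\ge m_{h_F}^F/n_F$ are regarded as true (and $M=m_{h_F}^F/n_F$ as false). Contact. For monic irreducible $F,G$, $c(F,G)=\max O_x(y-z)$ over roots $y$ of $F$, $z$ of $G$ (so $c(F,F)=+\infty$). Equivalence. For monic irreducible $F,G$: $G$ is equivalent to $F$ if $h_F=h_G$, $m_k^G/n_G=m_k^F/n_F$ for $1\le k\le h_F$, and $c(F,G)\ge m_{h_F}^F/n_F$. $G$ is almost equivalent to $F$ if $h_F=h_G+1$, $m_k^F/n_F=m_k^G/n_G$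 for $1\le k\le h_G$, and $c(F,G)=m_{h_F}^F/n_F$. A sequence $(F_1,\dots,F_r)$ is equivalent if every $F_i$ is equivalent to $F_1$ (a one-element sequence is equivalent); it is almost equivalent if $r>1$, it contains an equivalent subsequence of $r-1$ elements, and the remaining element is almost equivalent to the elements of that subsequence. Tree. Let $f=f_1\cdots f_{\xi(f)}$ be the factorization into irreducible components. $C(f)=\{c(f_p,f_q):p\ne q\}\cup\bigcup_k\{m_1^{f_k}/n_{f_k},\dots,m_{h_{f_k}}^{f_k}/n_{f_k}\}$. For $M\in C(f)$, $C_M(f)$ is the set of components $f_p$ such that $c(f_p,f_q)\ge M$ for some $q\neq p$, or $m_j^{f_p}/n_{f_p}\ge M$ for some $1\le j\le h_{f_p}$. On $C_M(f)$, $f_pR_Mf_q$ iff $p=q$ or $c(f_p,f_q)\ge M$; this is an equivalence relation, and its classes $P_1^M,\dots,P_{s_M}^M$ are the points of $T(f)$ at level $M$ (points at different levels are regarded as different). $P_j^N$ dominates $P_i^M$ if $N\ge M$ and $P_j^N\subseteq P_i^M$. $\mathrm{Top}(f)$ is the set of points maximal for domination. $Q_H(M,i)$ is the product (with multiplicities) of the irreducible components of $H$ whose contact with every element of $P_i^M$ equals $M$. *)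

theory Defs
  imports
    "HOL-Computational_Algebra.Computational_Algebra"
    "HOL-Computational_Algebra.Field_as_Ring"
    "HOL-Library.Extended_Real"
begin

text \<open>
  \<open>K((x))\<close> as a trivially Euclidean ring, in the manner of \<^theory>\<open>HOL-Computational_Algebra.Field_as_Ring\<close>;
  this makes \<open>K((x))[y]\<close> a factorial ring, so that \<^const>\<open>multiplicity\<close> applies to it.
\<close>

instantiation fls :: (field)
  "{unique_euclidean_ring, normalization_euclidean_semiring, normalization_semidom_multiplicative}"
begin

definition [simp]: "normalize_fls = (normalize_field :: 'a fls \<Rightarrow> _)"
definition [simp]: "unit_factor_fls = (unit_factor_field :: 'a fls \<Rightarrow> _)"
definition [simp]: "modulo_fls = (mod_field :: 'a fls \<Rightarrow> _)"
definition [simp]: "euclidean_size_fls = (euclidean_size_field :: 'a fls \<Rightarrow> _)"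
definition [simp]: "division_segment (x :: 'a fls) = 1"

instance
  by standard
    (simp_all add: dvd_field_iff field_split_simps split: if_splits)

end

instantiation fls :: (field) euclidean_ring_gcd
begin

definition gcd_fls :: "'a fls \<Rightarrow> 'a fls \<Rightarrow> 'a fls" where
  "gcd_fls = Euclidean_Algorithm.gcd"
definition lcm_fls :: "'a fls \<Rightarrow> 'a fls \<Rightarrow> 'a fls" where
  "lcm_fls = Euclidean_Algorithm.lcm"
definition Gcd_fls :: "'a fls set \<Rightarrow> 'a fls" where
  "Gcd_fls = Euclidean_Algorithm.Gcd"
definition Lcm_fls :: "'a fls set \<Rightarrow> 'a fls" where
  "Lcm_fls = Euclidean_Algorithm.Lcm"

instance
  by standard (simp_all add: gcd_fls_def lcm_fls_def Gcd_fls_def Lcm_fls_def)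

end

instance fls :: (field) field_gcd ..

text \<open>
  The series \<open>y(x\<^sup>1\<^sup>/\<^sup>p)\<close> in \<open>K((x\<^sup>1\<^sup>/\<^sup>p))\<close> is represented by the Laurent series \<open>y(t)\<close> in \<open>K((t))\<close>
  together with the ramification index \<open>p > 0\<close>, so that \<open>x = t\<^sup>p\<close>.
\<close>

definition puiseux_order :: "nat \<Rightarrow> 'a::zero fls \<Rightarrow> ereal" where
  "puiseux_order p y =
     (if y = 0 then \<infinity> else ereal (real_of_int (fls_subdegree y) / real p))"

text \<open>The roots of \<open>F\<close> lying in \<open>K((x\<^sup>1\<^sup>/\<^sup>p))\<close>, that is, the \<open>y(t)\<close> with \<open>F(t\<^sup>p, y(t)) = 0\<close>.\<close>

definition puiseux_roots :: "nat \<Rightarrow> 'a::field fls poly \<Rightarrow> 'a fls set" where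
  "puiseux_roots p F = {y. poly (map_poly (\<lambda>a. fls_compose_power a p) F) y = 0}"

definition monic_irreducible :: "'a::field fls poly \<Rightarrow> bool" where
  "monic_irreducible F \<longleftrightarrow> lead_coeff F = 1 \<and> irreducible F"

text \<open>
  A root \<open>y(t)\<close> with \<open>F(t\<^sup>n, y(t)) = 0\<close>, \<open>n = deg F\<close>. For irreducible \<open>F\<close> the other choices are
  \<open>y(w t)\<close> with \<open>w\<^sup>n = 1\<close>; all of them have the same support.
\<close>

definition newton_root :: "'a::field fls poly \<Rightarrow> 'a fls" where
  "newton_root F = (SOME y. y \<in> puiseux_roots (degree F) F)"

definition supp :: "'a::field fls poly \<Rightarrow> int set" where
  "supp F = {i. fls_nth (newton_root F) i \<noteq> 0}"

text \<open>
  The sequence \<open>d\<^sub>1, d\<^sub>2, \<dots>\<close>; the value at index \<open>0\<close> is a dummy. Once \<open>d\<^sub>k = 1\<close>, the infimum is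
  over the empty set and has an unspecified value, but the sequence stays at \<open>1\<close>.
\<close>

fun char_d :: "'a::field fls poly \<Rightarrow> nat \<Rightarrow> nat" where
  "char_d F 0 = degree F"
| "char_d F (Suc 0) = degree F"
| "char_d F (Suc (Suc k)) =
     nat (gcd (int (char_d F (Suc k))) (Inf {i \<in> supp F. \<not> int (char_d F (Suc k)) dvd i}))"

text \<open>Meaningful for \<open>1 \<le> k \<le> h\<close> only; the convention \<open>m\<^sub>h\<^sub>+\<^sub>1 = \<infinity>\<close> is not encoded here.\<close>

definition char_m :: "'a::field fls poly \<Rightarrow> nat \<Rightarrow> int" where
  "char_m F k = Inf {i \<in> supp F. \<not> int (char_d F k) dvd i}"

definition char_h :: "'a::field fls poly \<Rightarrow> nat" where
  "char_h F = (LEAST h. char_d F (Suc h) = 1)"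

definition char_e :: "'a::field fls poly \<Rightarrow> nat \<Rightarrow> nat" where
  "char_e F k = char_d F k div char_d F (Suc k)"

definition char_ratio :: "'a::field fls poly \<Rightarrow> nat \<Rightarrow> ereal" where
  "char_ratio F k = ereal (real_of_int (char_m F k) / real (degree F))"

text \<open>
  By Newton's theorem all roots of \<open>F\<close> and of \<open>G\<close> have \<open>deg F * deg G\<close> as a common
  ramification index, so this is the maximum over all pairs of roots.
\<close>

definition contact :: "'a::field fls poly \<Rightarrow> 'a fls poly \<Rightarrow> ereal" where
  "contact F G =
     (let p = degree F * degree G
      in Max {puiseux_order p (y - z) | y z. y \<in> puiseux_roots p F \<and> z \<in> puiseux_roots p G})"

text \<open>
  Comparisons with the last characteristic exponent: for \<open>h = 0\<close> the first two conditions count as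
  true and the third one as false.
\<close>

definition ge_last_exponent :: "ereal \<Rightarrow> 'a::field fls poly \<Rightarrow> bool" where
  "ge_last_exponent c F \<longleftrightarrow> char_h F = 0 \<or> c \<ge> char_ratio F (char_h F)"

definition gt_last_exponent :: "ereal \<Rightarrow> 'a::field fls poly \<Rightarrow> bool" where
  "gt_last_exponent c F \<longleftrightarrow> char_h F = 0 \<or> c > char_ratio F (char_h F)"

definition eq_last_exponent :: "ereal \<Rightarrow> 'a::field fls poly \<Rightarrow> bool" where
  "eq_last_exponent c F \<longleftrightarrow> char_h F \<noteq> 0 \<and> c = char_ratio F (char_h F)"

definition equivalent_to :: "'a::field fls poly \<Rightarrow> 'a fls poly \<Rightarrow> bool" where
  "equivalent_to G F \<longleftrightarrow>
     char_h F = char_h G \<and>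
     (\<forall>k\<in>{1..char_h F}. char_ratio G k = char_ratio F k) \<and>
     ge_last_exponent (contact F G) F"

definition almost_equivalent_to :: "'a::field fls poly \<Rightarrow> 'a fls poly \<Rightarrow> bool" where
  "almost_equivalent_to G F \<longleftrightarrow>
     char_h F = char_h G + 1 \<and>
     (\<forall>k\<in>{1..char_h G}. char_ratio F k = char_ratio G k) \<and>
     eq_last_exponent (contact F G) F"

definition equivalent_seq :: "'a::field fls poly list \<Rightarrow> bool" where
  "equivalent_seq Fs \<longleftrightarrow> (\<forall>F\<in>set Fs. equivalent_to F (hd Fs))"

definition almost_equivalent_seq :: "'a::field fls poly list \<Rightarrow> bool" where
  "almost_equivalent_seq Fs \<longleftrightarrow>
     length Fs > 1 \<and>
     (\<exists>As G Bs. Fs = As @ G # Bs \<and> equivalent_seq (As @ Bs) \<and>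
        (\<forall>F\<in>set (As @ Bs). almost_equivalent_to G F))"

definition components :: "'a::field fls poly \<Rightarrow> 'a fls poly set" where
  "components f = {g. monic_irreducible g \<and> g dvd f}"

definition levels :: "'a::field fls poly \<Rightarrow> ereal set" where
  "levels f =
     {contact p q | p q. p \<in> components f \<and> q \<in> components f \<and> p \<noteq> q} \<union>
     (\<Union>p\<in>components f. char_ratio p ` {1..char_h p})"

definition level_components :: "'a::field fls poly \<Rightarrow> ereal \<Rightarrow> 'a fls poly set" where
  "level_components f M =
     {p \<in> components f.
        (\<exists>q\<in>components f. q \<noteq> p \<and> contact p q \<ge> M) \<or>
        (\<exists>j\<in>{1..char_h p}. char_ratio p j \<ge> M)}"

definition level_rel :: "'a::field fls poly \<Rightarrow> ereal \<Rightarrow> ('a fls poly \<times> 'a fls poly) set" where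
  "level_rel f M =
     {(p, q). p \<in> level_components f M \<and> q \<in> level_components f M \<and>
        (p = q \<or> contact p q \<ge> M)}"

text \<open>A point is stored with its level, so that points at different levels are different.\<close>

definition tree_points :: "'a::field fls poly \<Rightarrow> (ereal \<times> 'a fls poly set) set" where
  "tree_points f = {(M, P). M \<in> levels f \<and> P \<in> level_components f M // level_rel f M}"

definition dominates :: "ereal \<times> 'a fls poly set \<Rightarrow> ereal \<times> 'a::field fls poly set \<Rightarrow> bool" where
  "dominates b a \<longleftrightarrow> fst b \<ge> fst a \<and> snd b \<subseteq> snd a"

definition Top :: "'a::field fls poly \<Rightarrow> (ereal \<times> 'a fls poly set) set" where
  "Top f = {a \<in> tree_points f. \<forall>b\<in>tree_points f. dominates b a \<longrightarrow> b = a}"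

definition Q_factor :: "'a::field fls poly \<Rightarrow> ereal \<Rightarrow> 'a fls poly set \<Rightarrow> 'a fls poly" where
  "Q_factor H M P =
     (\<Prod>g\<in>{g \<in> components H. \<forall>F\<in>P. contact g F = M}. g ^ multiplicity g H)"

end

theory Submission
  imports Defs
begin

text \<open>
  Over \<open>K((t))\<close> with \<open>x = t\<^sup>N\<close> and \<open>N\<close> divisible enough, \<open>f\<close> and \<open>f\<^sub>y\<close> split (Newton and Puiseux), and the roots of
  a component are conjugate under \<open>t \<mapsto> w t\<close>, \<open>w\<^sup>N = 1\<close>. In characteristic \<open>0\<close>, a closed ball that
  contains \<open>s > 0\<close> roots of \<open>f\<close> contains exactly \<open>s - 1\<close> roots of \<open>f\<^sub>y\<close>, because differentiation shifts the
  edges of the Newton polygon by one. Take the ball of radius \<open>M\<close> around a root of \<open>F\<^sub>1\<close>. As the point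
  is maximal and \<open>M\<close> is at least the last characteristic exponent of each \<open>F\<^sub>i\<close>, the roots of \<open>f\<close> in this
  ball are roots of \<open>F\<^sub>1, \<dots>, F\<^sub>r\<close> whose pairwise differences have order exactly \<open>M\<close>. A smaller
  ball around any of them contains no other root of \<open>f\<close>, hence no root of \<open>f\<^sub>y\<close>; so all \<open>s - 1\<close> roots of
  \<open>f\<^sub>y\<close> in the ball have contact exactly \<open>M\<close> with every \<open>F\<^sub>i\<close>. Each \<open>F\<^sub>i\<close> has one root in the ball,
  or \<open>e\<^sub>h = d\<^sub>h\<close> roots if \<open>M\<close> is its last characteristic exponent, and there are \<open>deg F\<^sub>1\<close> roots of \<open>F\<^sub>1\<close>,
  each ball containing one or \<open>d\<^sub>h\<close> of them.
\<close>

section \<open>Field homomorphisms acting on the coefficients of polynomials\<close>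

text \<open>Two kinds of instances occur: the substitution t -> t^d, which raises the ramification
  index, and the rotation t -> w t, which permutes conjugate roots. The locale moves polynomial
  identities, factorizations and roots along both.\<close>

locale field_hom =
  fixes h :: "'a::field \<Rightarrow> 'b::field"
  assumes hom_add: "h (x + y) = h x + h y"
    and hom_mult: "h (x * y) = h x * h y"
    and hom_1 [simp]: "h 1 = 1"
begin

lemma hom_0 [simp]: "h 0 = 0"
  using hom_add[of 0 0] by (metis add.right_neutral add_left_cancel)

lemma hom_uminus: "h (- x) = - h x"
  using hom_add[of x "-x"] by (simp add: eq_neg_iff_add_eq_0 add.commute)

lemma hom_diff: "h (x - y) = h x - h y"
  using hom_add[of x "-y"] by (simp add: hom_uminus)

lemma hom_eq_0_iff [simp]: "h x = 0 \<longleftrightarrow> x = 0"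
proof
  assume "h x = 0"
  show "x = 0"
  proof (rule ccontr)
    assume "x \<noteq> 0"
    then have "h (x * inverse x) = 1" by simp
    with \<open>h x = 0\<close> show False unfolding hom_mult by simp
  qed
qed simp

lemma hom_eq_iff [simp]: "h x = h y \<longleftrightarrow> x = y"
  using hom_eq_0_iff[of "x - y"] by (simp add: hom_diff del: hom_eq_0_iff)

lemma hom_sum: "h (sum f A) = (\<Sum>x\<in>A. h (f x))"
  by (induction A rule: infinite_finite_induct) (auto simp: hom_add)

lemma hom_of_nat: "h (of_nat n) = of_nat n"
  by (induction n) (auto simp: hom_add)

lemma coeff_hom [simp]: "coeff (map_poly h p) i = h (coeff p i)"
  by (simp add: coeff_map_poly)

lemma degree_hom [simp]: "degree (map_poly h p) = degree p"
  by (rule degree_map_poly) simp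

lemma map_poly_hom_eq_0_iff [simp]: "map_poly h p = 0 \<longleftrightarrow> p = 0"
  by (auto simp: poly_eq_iff)

lemma map_poly_hom_add: "map_poly h (p + q) = map_poly h p + map_poly h q"
  by (rule poly_eqI) (simp add: hom_add)

lemma map_poly_hom_mult: "map_poly h (p * q) = map_poly h p * map_poly h q"
  by (rule poly_eqI) (simp add: coeff_mult hom_sum hom_mult)

lemma map_poly_hom_pCons: "map_poly h (pCons c p) = pCons (h c) (map_poly h p)"
  by (rule map_poly_pCons) simp

lemma map_poly_hom_1: "map_poly h 1 = 1"
  by (simp add: map_poly_1')

lemma map_poly_hom_power: "map_poly h (p ^ n) = map_poly h p ^ n"
  by (induction n) (auto simp: map_poly_hom_mult map_poly_hom_1)

lemma map_poly_hom_prod: "map_poly h (prod f A) = (\<Prod>x\<in>A. map_poly h (f x))"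
  by (induction A rule: infinite_finite_induct) (auto simp: map_poly_hom_mult map_poly_hom_1)

lemma map_poly_hom_smult: "map_poly h (smult c p) = smult (h c) (map_poly h p)"
  by (rule poly_eqI) (simp add: hom_mult)

lemma map_poly_hom_pderiv: "map_poly h (pderiv p) = pderiv (map_poly h p)"
  by (rule poly_eqI) (simp add: coeff_pderiv hom_mult hom_of_nat hom_add)

lemma map_poly_hom_pcompose: "map_poly h (pcompose p q) = pcompose (map_poly h p) (map_poly h q)"
  by (induction p) (simp_all add: pcompose_pCons map_poly_hom_pCons map_poly_hom_add map_poly_hom_mult)

lemma poly_hom: "poly (map_poly h p) (h x) = h (poly p x)"
  by (induction p) (simp_all add: map_poly_hom_pCons hom_add hom_mult)

lemma map_poly_hom_linear: "map_poly h [:- z, 1:] = [:- h z, 1:]"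
  by (simp add: map_poly_hom_pCons hom_uminus)

end

section \<open>The substitution t -> t^d on Laurent series\<close>

lemma field_hom_compose_power: "d > 0 \<Longrightarrow> field_hom (\<lambda>a::'a::field fls. fls_compose_power a d)"
  by unfold_locales auto

lemma fls_compose_power_compose_power:
  "d > 0 \<Longrightarrow> e > 0 \<Longrightarrow> fls_compose_power (fls_compose_power a d) e = fls_compose_power a (d * e)"
proof (rule fls_eqI)
  fix n :: int
  assume de: "d > 0" "e > 0"
  have "int e dvd n \<and> int d dvd n div int e \<longleftrightarrow> int (d * e) dvd n"
    using de by (auto simp: elim!: dvdE)
  moreover have "n div int e div int d = n div int (d * e)"
    using zdiv_zmult2_eq[of "int d" n "int e"] by (simp add: mult.commute)
  ultimately show "fls_nth (fls_compose_power (fls_compose_power a d) e) n =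
      fls_nth (fls_compose_power a (d * e)) n"
    using de by (auto simp: fls_nth_compose_power)
qed

lemma fls_compose_power_1 [simp]: "fls_compose_power a (Suc 0) = a"
  by (rule fls_eqI) (simp add: fls_nth_compose_power)

lemma fls_subdegree_compose_power:
  assumes "d > 0" "a \<noteq> 0"
  shows "fls_subdegree (fls_compose_power a d) = int d * fls_subdegree a"
proof (rule fls_subdegree_eqI)
  show "fls_nth (fls_compose_power a d) (int d * fls_subdegree a) \<noteq> 0"
    using assms by (simp add: fls_nth_compose_power)
  fix n assume n: "n < int d * fls_subdegree a"
  show "fls_nth (fls_compose_power a d) n = 0"
  proof (cases "int d dvd n")
    case True
    then obtain k where "n = int d * k" by blast
    with n assms show ?thesis by (simp add: fls_nth_compose_power)
  qed (use assms in \<open>simp add: fls_nth_compose_power\<close>)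
qed

text \<open>Well-definedness of the order in x: raising the ramification index multiplies the order
  in t and the index by the same d.\<close>

lemma puiseux_order_compose_power:
  assumes "d > 0" "n > 0"
  shows "puiseux_order (n * d) (fls_compose_power a d) = puiseux_order n (a :: 'a :: field fls)"
proof -
  interpret field_hom "\<lambda>a::'a fls. fls_compose_power a d" by (rule field_hom_compose_power[OF assms(1)])
  show ?thesis
    using assms by (auto simp: puiseux_order_def fls_subdegree_compose_power field_simps)
qed

text \<open>Descent to a smaller ramification index. It brings invariant coefficients back to K((x))
  in \<open>puiseux_roots_conj\<close> and removes common factors of exponents in
  \<open>newton_puiseux\<close>.\<close>

lemma ex_compose_power:
  assumes "d > 0" "\<And>i. fls_nth a i \<noteq> 0 \<Longrightarrow> int d dvd i"
  shows "\<exists>b. a = fls_compose_power (b :: 'a :: field fls) d"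
proof -
  define b where "b = Abs_fls (\<lambda>i. fls_nth a (int d * i))"
  have b: "fls_nth b i = fls_nth a (int d * i)" for i
    unfolding b_def
  proof (rule nth_Abs_fls_lower_bound[of "min 0 (fls_subdegree a)"], safe)
    fix k assume k: "k < min 0 (fls_subdegree a)"
    \<comment> \<open>Multiplication by \<open>d\<close> lowers a negative \<open>k\<close> at most
      further, but not a positive one; hence the cap at 0 in the lower bound.\<close>
    have "int d * k \<le> 1 * k"
      using k assms(1) by (intro mult_right_mono_neg) auto
    with k have "int d * k < fls_subdegree a" by linarith
    then show "fls_nth a (int d * k) = 0" by simp
  qed
  have "a = fls_compose_power b d"
    using assms by (intro fls_eqI) (auto simp: fls_nth_compose_power b)
  then show ?thesis by blast
qed

section \<open>Roots of unity and the action on Laurent series\<close>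

definition mu :: "nat \<Rightarrow> 'a::field set" where
  "mu n = {w. w ^ n = 1}"

text \<open>The automorphism t -> w t of K((t)). For \<open>w\<close> in \<open>mu N\<close> these
  automorphisms form the Galois group over K((x)), x = t^N.\<close>

definition rot :: "'a::field \<Rightarrow> 'a fls \<Rightarrow> 'a fls" where
  "rot w a = fls_compose_fps a (fps_const w * fps_X)"

lemma mu_nonzero: "n > 0 \<Longrightarrow> w \<in> mu n \<Longrightarrow> w \<noteq> 0"
  by (auto simp: mu_def power_0_left)

lemma one_in_mu [simp]: "1 \<in> mu n"
  by (simp add: mu_def)

lemma mu_mult: "w \<in> mu n \<Longrightarrow> z \<in> mu n \<Longrightarrow> w * z \<in> mu n"
  by (simp add: mu_def power_mult_distrib)

lemma mu_inverse: "w \<in> mu n \<Longrightarrow> inverse w \<in> mu n"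
  by (simp add: mu_def power_inverse)

lemma mu_dvd: "m dvd n \<Longrightarrow> mu m \<subseteq> mu n"
  by (auto simp: mu_def power_mult elim!: dvdE)

lemma fls_nth_rot: "w \<noteq> 0 \<Longrightarrow> fls_nth (rot w a) n = fls_nth a n * w powi n"
  unfolding rot_def by (rule fls_nth_fls_compose_fps_linear)

lemma field_hom_rot: "w \<noteq> 0 \<Longrightarrow> field_hom (rot w)"
  unfolding rot_def by unfold_locales (auto simp: fls_compose_fps_add fls_compose_fps_mult)

lemma rot_rot: "w \<noteq> 0 \<Longrightarrow> z \<noteq> 0 \<Longrightarrow> rot w (rot z a) = rot (w * z) a"
  by (rule fls_eqI) (simp add: fls_nth_rot power_int_mult_distrib)

lemma rot_1 [simp]: "rot 1 a = a"
  by (rule fls_eqI) (simp add: fls_nth_rot)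

lemma rot_compose_power:
  assumes "w \<in> mu d" "d > 0"
  shows "rot w (fls_compose_power a d) = fls_compose_power a d"
proof (rule fls_eqI)
  fix n
  have "w \<noteq> 0" using assms mu_nonzero by blast
  moreover have "w powi n = 1" if "int d dvd n"
    using that assms by (auto simp: mu_def power_int_mult elim!: dvdE)
  ultimately show "fls_nth (rot w (fls_compose_power a d)) n = fls_nth (fls_compose_power a d) n"
    using assms by (auto simp: fls_nth_rot fls_nth_compose_power)
qed

lemma rot_compose_power':
  assumes "w \<noteq> 0" "d > 0"
  shows "rot w (fls_compose_power a d) = fls_compose_power (rot (w ^ d) a) d"
  using assms by (intro fls_eqI) (auto simp: fls_nth_rot fls_nth_compose_power power_int_mult elim!: dvdE)

lemma fls_subdegree_rot: "w \<noteq> 0 \<Longrightarrow> fls_subdegree (rot w a) = fls_subdegree a"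
  by (cases "a = 0") (simp add: rot_def, auto intro!: fls_subdegree_eqI simp: fls_nth_rot)

lemma puiseux_order_rot: "w \<noteq> 0 \<Longrightarrow> puiseux_order n (rot w a) = puiseux_order n a"
  using field_hom.hom_eq_0_iff[OF field_hom_rot, of w a]
  by (simp add: puiseux_order_def fls_subdegree_rot)

text \<open>Here \<open>e\<close> is the order of \<open>w\<close>, the least positive exponent with
  value 1. The remainder of \<open>i\<close> modulo \<open>e\<close> is again such an exponent, so
  minimality makes it 0; integer powers cover the negative exponents of Laurent series.\<close>

lemma mu_order:
  assumes "w \<in> mu n" "n > 0"
  obtains e where "e > 0" "\<And>i. w powi i = 1 \<longleftrightarrow> int e dvd i"
proof -
  define e where "e = (LEAST e. e > 0 \<and> w ^ e = 1)"
  have ex: "n > 0 \<and> w ^ n = 1" using assms by (simp add: mu_def)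
  have e: "e > 0 \<and> w ^ e = 1" unfolding e_def by (rule LeastI, rule ex)
  have w0: "w \<noteq> 0" using assms mu_nonzero by blast
  have "w powi i = 1 \<longleftrightarrow> int e dvd i" for i
  proof
    assume i: "w powi i = 1"
    have "i = int e * (i div int e) + i mod int e" by simp
    then have "w powi i = (w powi int e) powi (i div int e) * w powi (i mod int e)"
      by (metis power_int_add power_int_mult w0)
    with i e have "w powi (i mod int e) = 1" by simp
    moreover have m: "0 \<le> i mod int e" "i mod int e < int e" using e by auto
    ultimately have "w ^ nat (i mod int e) = 1" by (simp add: power_int_def)
    with not_less_Least[of "nat (i mod int e)" "\<lambda>e. e > 0 \<and> w ^ e = 1"] m
    have "\<not> nat (i mod int e) > 0" unfolding e_def[symmetric] by auto
    with m show "int e dvd i" by (simp add: dvd_eq_mod_eq_0)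
  next
    assume "int e dvd i"
    then show "w powi i = 1" using e by (auto simp: power_int_mult elim!: dvdE)
  qed
  with e that show thesis by blast
qed

text \<open>In characteristic 0 the polynomial X^n - 1 has no root in common with its derivative. It
  is therefore a product of n distinct linear factors over the algebraically closed field.\<close>

lemma card_mu:
  assumes "n > 0"
  shows "card (mu n :: 'a::{alg_closed_field, field_char_0} set) = n" and
    "finite (mu n :: 'a set)"
proof -
  define p :: "'a poly" where "p = monom 1 n - 1"
  have deg: "degree p = n"
    unfolding p_def using assms by (subst diff_conv_add_uminus, subst degree_add_eq_left) (auto simp: degree_monom_eq)
  have p0: "p \<noteq> 0" using deg assms by auto
  have roots: "{x. poly p x = 0} = mu n"
    by (auto simp: p_def poly_monom mu_def)
  show "finite (mu n :: 'a set)" using poly_roots_finite[OF p0] roots by simp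
  have "rsquarefree p"
    unfolding rsquarefree_roots
  proof safe
    fix a assume a: "poly p a = 0" "poly (pderiv p) a = 0"
    have "a ^ n = 1" using a(1) by (simp add: p_def poly_monom)
    moreover have "of_nat n * a ^ (n - 1) = 0"
      using a(2) by (simp add: p_def pderiv_diff pderiv_monom poly_monom)
    ultimately show False using assms by (auto simp: power_0_left)
  qed
  then have ord: "order x p = (if poly p x = 0 then 1 else 0)" for x
    using p0 by (metis One_nat_def order_root rsquarefree_def)
  obtain A where A: "size A = degree p" "p = smult (lead_coeff p) (\<Prod>x\<in>#A. [:-x, 1:])"
    using alg_closed_imp_factorization[OF p0] by blast
  have "proots p = proots (\<Prod>x\<in>#A. [:-x, 1:])"
    using p0 by (subst A(2)) (simp add: proots_smult)
  also have "\<dots> = A"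
  proof (induction A)
    case (add x A)
    have "(\<Prod>x\<in>#A. [:- x, 1:]) \<noteq> 0" by (auto simp: prod_mset_zero_iff)
    with add show ?case by (simp add: proots_mult del: mult_pCons_left)
  qed simp
  finally have "proots p = A" .
  then have "A = mset_set (mu n)"
    using p0 roots \<open>finite (mu n)\<close> ord by (intro multiset_eqI) (auto simp: count_mset_set' simp flip: \<open>proots p = A\<close>)
  with A(1) deg show "card (mu n :: 'a set) = n" by simp
qed

text \<open>The order of each such \<open>w\<close> divides g = gcd(n, i), so \<open>mu n\<close> is
  contained in \<open>mu g\<close>, and comparing cardinalities gives g = n. This turns invariance
  under all rotations into divisibility of exponents.\<close>

lemma mu_all_powi_imp_dvd:
  assumes "n > 0" "\<And>w::'a::{alg_closed_field, field_char_0}. w \<in> mu n \<Longrightarrow> w powi i = 1"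
  shows "int n dvd i"
proof -
  define g where "g = nat (gcd (int n) i)"
  have g: "int g = gcd (int n) i" "g > 0" using assms(1) by (auto simp: g_def)
  have "(mu n :: 'a set) \<subseteq> mu g"
  proof
    fix w :: 'a assume w: "w \<in> mu n"
    obtain e where e: "\<And>i. w powi i = 1 \<longleftrightarrow> int e dvd i" using mu_order[OF w assms(1)] by blast
    have "int e dvd int n" using w e[of "int n"] by (simp add: mu_def)
    moreover have "int e dvd i" using assms(2)[OF w] e by blast
    ultimately have "int e dvd int g" using g by simp
    then show "w \<in> mu g" using e[of "int g"] by (simp add: mu_def)
  qed
  then have "n \<le> g" using card_mono[OF card_mu(2)[OF g(2)]] card_mu(1)[of n] card_mu(1)[OF g(2)] assms(1) by metis
  moreover have "int g dvd int n" "int g dvd i" using g by auto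
  ultimately show ?thesis using assms(1) by (metis dvd_imp_le le_antisym of_nat_dvd_iff)
qed

section \<open>Hensel's lemma and Puiseux's theorem\<close>

lemma coprime_poly_bezout:
  fixes p q :: "'a::field poly"
  assumes "coprime p q"
  shows "\<exists>u v. u * p + v * q = 1"
  using assms
proof (induction "euclidean_size q" arbitrary: p q rule: less_induct)
  case less
  show ?case
  proof (cases "q = 0")
    case True
    with less.prems have "p dvd 1" by simp
    then obtain u where "1 = p * u" by (elim dvdE)
    then have "u * p + 0 * q = 1" by (simp add: mult.commute)
    then show ?thesis by blast
  next
    case False
    have "coprime q (p mod q)"
      using less.prems by (metis False coprime_commute coprime_mod_left_iff)
    moreover have "euclidean_size (p mod q) < euclidean_size q"
      using False by (rule mod_size_less)
    ultimately obtain u v where "u * q + v * (p mod q) = 1"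
      using less.hyps by blast
    moreover have "p mod q = p - (p div q) * q"
      by (simp add: minus_div_mult_eq_mod)
    ultimately have "v * p + (u - v * (p div q)) * q = 1"
      by (simp add: algebra_simps)
    then show ?thesis by blast
  qed
qed

text \<open>Multiply a Bezout identity by \<open>e\<close> and reduce the cofactor of
  \<open>h\<close> modulo \<open>g\<close>. The bound on \<open>degree b\<close> is then forced by
  the equation, since \<open>e - h * a\<close> has degree below deg g + deg h.\<close>

lemma coprime_poly_solve:
  fixes g h e :: "'a::field poly"
  assumes "coprime g h" "degree g > 0" "degree h > 0" "degree e < degree g + degree h"
  shows "\<exists>a b. degree a < degree g \<and> degree b < degree h \<and> e = g * b + h * a"
proof -
  obtain u v where uv: "u * g + v * h = 1"
    using coprime_poly_bezout[OF assms(1)] by blast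
  define a where "a = (e * v) mod g"
  define b where "b = e * u + h * ((e * v) div g)"
  have "e = e * (u * g + v * h)" using uv by simp
  also have "\<dots> = g * (e * u) + h * ((e * v) div g * g + (e * v) mod g)"
    by (simp add: algebra_simps)
  also have "\<dots> = g * b + h * a"
    unfolding a_def b_def by (simp only: ring_distribs mult_ac add_ac)
  finally have e: "e = g * b + h * a" .
  have "g \<noteq> 0" "h \<noteq> 0" using assms by auto
  have a: "degree a < degree g"
    using degree_mod_less[OF \<open>g \<noteq> 0\<close>, of "e * v"] assms(2) by (auto simp: a_def)
  have "degree b < degree h"
  proof (cases "b = 0")
    case False
    have "degree (h * a) < degree g + degree h"
      using a degree_mult_le[of h a] by linarith
    with assms(4) have "degree (e - h * a) < degree g + degree h"
      by (rule degree_diff_less)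
    moreover have "e - h * a = g * b" using e by simp
    ultimately show ?thesis using False \<open>g \<noteq> 0\<close> by (simp add: degree_mult_eq)
  qed (use assms in simp)
  with a e show ?thesis by blast
qed

text \<open>Here \<open>f k\<close> is the coefficient of t^k, a polynomial in y. In the k-th
  equation the unknowns occur only in \<open>g * H k + h * G k\<close>; the other terms are already
  known and have small degree, so \<open>coprime_poly_solve\<close> applies.\<close>

lemma hensel_layers:
  fixes g h :: "'a::field poly" and f :: "nat \<Rightarrow> 'a poly"
  assumes "coprime g h" "degree g > 0" "degree h > 0" "f 0 = g * h"
    and deg: "\<And>k. k > 0 \<Longrightarrow> degree (f k) < degree g + degree h"
  shows "\<exists>G H. G 0 = g \<and> H 0 = h \<and>
      (\<forall>k>0. degree (G k) < degree g \<and> degree (H k) < degree h) \<and>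
      (\<forall>k. f k = (\<Sum>l\<le>k. G l * H (k - l)))"
proof -
  \<comment> \<open>\<open>P F k r\<close> says that \<open>r\<close> may serve as the k-th pair
    once the pairs \<open>F l\<close> with l < k are chosen. The sum omits l = 0 and l = k, which
    are the two terms with an unknown factor.\<close>
  define P where "P = (\<lambda>(F :: nat \<Rightarrow> 'a poly \<times> 'a poly) k r.
    if k = 0 then r = (g, h) else degree (fst r) < degree g \<and> degree (snd r) < degree h \<and>
      f k = g * snd r + h * fst r + (\<Sum>l\<in>{0<..<k}. fst (F l) * snd (F (k - l))))"
  have "\<exists>F. \<forall>k. P F k (F k)"
  proof (rule dependent_wf_choice[of less_than])
    show "wf less_than" by simp
  next
    fix F F' :: "nat \<Rightarrow> 'a poly \<times> 'a poly" and k r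
    assume *: "\<And>z. (z, k) \<in> less_than \<Longrightarrow> F z = F' z"
    have "(\<Sum>l\<in>{0<..<k}. fst (F l) * snd (F (k - l))) = (\<Sum>l\<in>{0<..<k}. fst (F' l) * snd (F' (k - l)))"
      using * by (intro sum.cong) auto
    then show "P F k r = P F' k r" unfolding P_def by simp
  next
    fix k and F :: "nat \<Rightarrow> 'a poly \<times> 'a poly"
    assume IH: "\<And>y. (y, k) \<in> less_than \<Longrightarrow> P F y (F y)"
    show "\<exists>r. P F k r"
    proof (cases "k = 0")
      case False
      define e where "e = f k - (\<Sum>l\<in>{0<..<k}. fst (F l) * snd (F (k - l)))"
      have "degree (fst (F l) * snd (F (k - l))) < degree g + degree h" if "l \<in> {0<..<k}" for l
        using IH[of l] IH[of "k - l"] that degree_mult_le[of "fst (F l)" "snd (F (k - l))"]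
        by (auto simp: P_def)
      then have "degree (\<Sum>l\<in>{0<..<k}. fst (F l) * snd (F (k - l))) < degree g + degree h"
        using assms(2) by (intro degree_sum_less) auto
      then have "degree e < degree g + degree h"
        unfolding e_def using deg False by (intro degree_diff_less) auto
      from coprime_poly_solve[OF assms(1-3) this] obtain a b where
        "degree a < degree g" "degree b < degree h" "e = g * b + h * a" by blast
      then have "P F k (a, b)" using False by (simp add: P_def e_def algebra_simps)
      then show ?thesis by blast
    qed (auto simp: P_def)
  qed
  then obtain F where F: "\<And>k. P F k (F k)" by blast
  have 0: "F 0 = (g, h)" using F[of 0] by (simp add: P_def)
  have "f k = (\<Sum>l\<le>k. fst (F l) * snd (F (k - l)))" for k
  proof (cases "k = 0")
    case True
    then show ?thesis using 0 assms(4) by simp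
  next
    case False
    have "{..k} = insert 0 (insert k {0<..<k})" using False by auto
    then have "(\<Sum>l\<le>k. fst (F l) * snd (F (k - l))) =
      g * snd (F k) + (fst (F k) * h + (\<Sum>l\<in>{0<..<k}. fst (F l) * snd (F (k - l))))"
      using False 0 by simp
    also have "\<dots> = f k" using F[of k] False by (simp add: P_def algebra_simps)
    finally show ?thesis by simp
  qed
  moreover have "\<forall>k>0. degree (fst (F k)) < degree g \<and> degree (snd (F k)) < degree h"
    using F by (auto simp: P_def)
  ultimately show ?thesis using 0
    by (intro exI[of _ "\<lambda>k. fst (F k)"] exI[of _ "\<lambda>k. snd (F k)"]) auto
qed

text \<open>Transposes a power series in t with polynomial coefficients into a polynomial in y with
  power series coefficients; the degree bound \<open>d\<close> makes the sum finite.\<close>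

definition poly_of_layers :: "nat \<Rightarrow> (nat \<Rightarrow> 'a::field poly) \<Rightarrow> 'a fls poly" where
  "poly_of_layers d G = (\<Sum>i\<le>d. monom (fps_to_fls (Abs_fps (\<lambda>k. coeff (G k) i))) i)"

lemma coeff_poly_of_layers:
  assumes "\<And>k. degree (G k) \<le> d"
  shows "coeff (poly_of_layers d G) i = fps_to_fls (Abs_fps (\<lambda>k. coeff (G k) i))"
proof (cases "i \<le> d")
  case True
  then show ?thesis by (simp add: poly_of_layers_def coeff_sum)
next
  case False
  have "coeff (G k) i = 0" for k
    using assms[of k] False by (intro coeff_eq_0) linarith
  then have "Abs_fps (\<lambda>k. coeff (G k) i) = 0"
    by (simp add: fps_eq_iff)
  with False show ?thesis by (simp add: poly_of_layers_def coeff_sum)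
qed

text \<open>Since \<open>F\<close> is monic, only the layer at t^0 reaches the full degree, so all
  later layers satisfy the degree bound of \<open>hensel_layers\<close>. Reading its convolution
  identity coefficientwise in y gives the product.\<close>

lemma hensel:
  fixes F :: "'a::field fls poly" and g h :: "'a poly"
  assumes int: "\<And>i. fls_subdegree (coeff F i) \<ge> 0"
    and monic: "lead_coeff F = 1"
    and red: "map_poly (\<lambda>a. fls_nth a 0) F = g * h"
    and cop: "coprime g h" "degree g > 0" "degree h > 0"
  shows "\<exists>G H. F = G * H \<and> degree G = degree g \<and> degree H = degree h"
proof -
  define f where "f = (\<lambda>k::nat. map_poly (\<lambda>a. fls_nth a (int k)) F)"
  have coeff_f: "coeff (f k) i = fls_nth (coeff F i) (int k)" for k i
    unfolding f_def by (simp add: coeff_map_poly)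
  have f0: "f 0 = g * h" using red by (simp add: f_def)
  have "g \<noteq> 0" "h \<noteq> 0" using cop by auto
  have "degree (f 0) = degree F"
    using monic by (intro antisym degree_le le_degree) (auto simp: coeff_f coeff_eq_0)
  then have dF: "degree F = degree g + degree h"
    using f0 \<open>g \<noteq> 0\<close> \<open>h \<noteq> 0\<close> by (simp add: degree_mult_eq)
  have "degree (f k) < degree g + degree h" if "k > 0" for k
  proof -
    have "coeff (f k) i = 0" if "i \<ge> degree F" for i
      using that \<open>k > 0\<close> monic by (cases "i = degree F") (auto simp: coeff_f coeff_eq_0)
    then have "degree (f k) \<le> degree F - 1" by (intro degree_le) auto
    then show ?thesis using dF cop by linarith
  qed
  from hensel_layers[of g h f, OF cop f0 this] obtain G H where
    GH: "G 0 = g" "H 0 = h" "\<And>k. k > 0 \<Longrightarrow> degree (G k) < degree g"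
      "\<And>k. k > 0 \<Longrightarrow> degree (H k) < degree h" "\<And>k. f k = (\<Sum>l\<le>k. G l * H (k - l))"
    by blast
  have dG: "degree (G k) \<le> degree g" and dH: "degree (H k) \<le> degree h" for k
    using GH(1,2) GH(3,4)[of k] by (cases "k = 0"; auto)+
  let ?G = "poly_of_layers (degree g) G" and ?H = "poly_of_layers (degree h) H"
  have cG: "coeff ?G i = fps_to_fls (Abs_fps (\<lambda>k. coeff (G k) i))" for i
    by (rule coeff_poly_of_layers[OF dG])
  have cH: "coeff ?H i = fps_to_fls (Abs_fps (\<lambda>k. coeff (H k) i))" for i
    by (rule coeff_poly_of_layers[OF dH])
  have "F = ?G * ?H"
  proof (rule poly_eqI)
    fix i
    have "coeff F i = fps_to_fls (Abs_fps (\<lambda>k. fls_nth (coeff F i) (int k)))"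
      using int[of i] by (intro fls_eqI) auto
    also have "Abs_fps (\<lambda>k. fls_nth (coeff F i) (int k)) =
      (\<Sum>j\<le>i. Abs_fps (\<lambda>k. coeff (G k) j) * Abs_fps (\<lambda>k. coeff (H k) (i - j)))"
    proof (rule fps_ext)
      fix k
      have "fls_nth (coeff F i) (int k) = coeff (f k) i" by (simp add: coeff_f)
      also have "\<dots> = (\<Sum>l\<le>k. \<Sum>j\<le>i. coeff (G l) j * coeff (H (k - l)) (i - j))"
        by (simp add: GH(5) coeff_sum coeff_mult)
      also have "\<dots> = (\<Sum>j\<le>i. \<Sum>l\<le>k. coeff (G l) j * coeff (H (k - l)) (i - j))"
        by (rule sum.swap)
      finally show "fps_nth (Abs_fps (\<lambda>k. fls_nth (coeff F i) (int k))) k =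
        fps_nth (\<Sum>j\<le>i. Abs_fps (\<lambda>k. coeff (G k) j) * Abs_fps (\<lambda>k. coeff (H k) (i - j))) k"
        by (simp add: fps_sum_nth fps_mult_nth atMost_atLeast0)
    qed
    also have "fps_to_fls (\<Sum>j\<in>A. g j) = (\<Sum>j\<in>A. fps_to_fls (g j))" for A :: "nat set" and g :: "nat \<Rightarrow> 'a fps"
      by (induction A rule: infinite_finite_induct) auto
    also have "(\<Sum>j\<le>i. fps_to_fls (Abs_fps (\<lambda>k. coeff (G k) j) * Abs_fps (\<lambda>k. coeff (H k) (i - j)))) = (\<Sum>j\<le>i. coeff ?G j * coeff ?H (i - j))"
      by (simp add: cG cH fls_times_fps_to_fls)
    finally show "coeff F i = coeff (?G * ?H) i" by (simp add: coeff_mult)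
  qed
  moreover have "degree ?G \<le> degree g"
    using le_less_trans[OF dG] by (intro degree_le) (auto simp: cG fps_to_fls_eq_0_iff fps_eq_iff intro!: coeff_eq_0)
  moreover have "degree ?H \<le> degree h"
    using dH by (intro degree_le) (auto simp: cH fps_to_fls_eq_0_iff fps_eq_iff intro!: coeff_eq_0 intro: le_less_trans)
  moreover have "degree (?G * ?H) \<le> degree ?G + degree ?H" by (rule degree_mult_le)
  ultimately have "degree ?G = degree g" "degree ?H = degree h" using dF by auto
  with \<open>F = ?G * ?H\<close> show ?thesis by blast
qed

section \<open>The Newton polygon step and existence of Puiseux roots\<close>

text \<open>With a single root c the polynomial would be (y - c)^n, whose subleading coefficient is
  -n c. In characteristic 0 this gives c = 0, hence y^n, against the nonzero coefficient at
  \<open>i\<close>.\<close>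

lemma two_distinct_roots:
  fixes p :: "'a::{alg_closed_field, field_char_0} poly"
  assumes "lead_coeff p = 1" "degree p > 1" "coeff p (degree p - 1) = 0" "i < degree p" "coeff p i \<noteq> 0"
  shows "\<exists>x y. x \<noteq> y \<and> poly p x = 0 \<and> poly p y = 0"
proof (rule ccontr)
  assume *: "\<not> ?thesis"
  have "p \<noteq> 0" using assms by auto
  obtain A where A: "size A = degree p" "p = (\<Prod>x\<in>#A. [:-x, 1:])"
    using alg_closed_imp_factorization[OF \<open>p \<noteq> 0\<close>] assms(1) by auto
  obtain c where c: "poly p c = 0"
    using alg_closed_imp_poly_has_root[of p] assms(2) by auto
  have root: "poly p x = 0" if "x \<in># A" for x
    using that by (subst A(2)) (auto simp: poly_prod_mset image_iff)
  have "set_mset A \<subseteq> {c}" using root c * by blast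
  then have "A = replicate_mset (degree p) c"
    using A(1) by (metis set_mset_subset_singletonD)
  then have "p = [:- c, 1:] ^ degree p"
    using A(2) by (metis image_replicate_mset prod_mset_replicate_mset)
  then have pi: "coeff p j = of_nat (degree p choose j) * (- c) ^ (degree p - j)" if "j \<le> degree p" for j
    using that coeff_linear_poly_power[of j "degree p" "- c" 1] by simp
  have "c = 0"
    using pi[of "degree p - 1"] assms by auto
  with pi[of i] assms show False by simp
qed

text \<open>The Tschirnhaus shift: the derivative of order deg p - 1 is linear, and its root is the
  required translation, because differentiation commutes with translation.\<close>

lemma exists_shift_without_subleading:
  fixes p :: "'a::field_char_0 poly"
  assumes "degree p > 0"
  shows "\<exists>s. coeff (pcompose p [:s, 1:]) (degree p - 1) = 0"
proof -
  define k where "k = degree p - 1"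
  have "degree ((pderiv ^^ k) p) = 1"
    using assms by (simp add: degree_higher_pderiv k_def)
  then obtain a b where ab: "(pderiv ^^ k) p = [:b, a:]" "a \<noteq> 0"
    using degree1_coeffs by metis
  define s where "s = - b / a"
  have "(pderiv ^^ j) (pcompose p [:s, 1:]) = pcompose ((pderiv ^^ j) p) [:s, 1:]" for j
    by (induction j) (simp_all add: pderiv_pcompose pderiv_pCons)
  then have "coeff ((pderiv ^^ k) (pcompose p [:s, 1:])) 0 = 0"
    using ab by (simp add: s_def)
  then have "coeff (pcompose p [:s, 1:]) k = 0"
    by (simp add: coeff_higher_pderiv pochhammer_fact[symmetric])
  then show ?thesis unfolding k_def by blast
qed

text \<open>One step of Newton's algorithm. A substitution x = t^q, y -> t^u y makes the edge of the
  Newton polygon that leaves the leading term horizontal. The reduction at t = 0 keeps the vanishing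
  subleading coefficient and has a further nonzero coefficient, so it has two distinct roots, and
  Hensel's lemma lifts a coprime splitting.\<close>

lemma newton_slope_factor:
  fixes F :: "'a::{alg_closed_field, field_char_0} fls poly"
  assumes "lead_coeff F = 1" "degree F > 1" "coeff F (degree F - 1) = 0" "i < degree F" "coeff F i \<noteq> 0"
  shows "\<exists>q u c G H. q > 0 \<and> c \<noteq> 0 \<and> 0 < degree G \<and> degree G < degree F \<and>
    G * H = smult c (pcompose (map_poly (\<lambda>a. fls_compose_power a q) F) [:0, fls_X_intpow u:])"
proof -
  define n where "n = degree F"
  define I where "I = {i. i < n \<and> coeff F i \<noteq> 0}"
  define sl where "sl = (\<lambda>i. real_of_int (fls_subdegree (coeff F i)) / real (n - i))"
  have I: "finite I" "I \<noteq> {}" using assms by (auto simp: I_def n_def)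
  define i0 where "i0 = arg_min_on sl I"
  have i0: "i0 \<in> I" using I unfolding i0_def by (rule arg_min_if_finite)
  have min: "sl i0 \<le> sl i" if "i \<in> I" for i
    using I that unfolding i0_def by (rule arg_min_least)
  \<comment> \<open>The least slope is u / q, not necessarily in lowest terms. After the
    substitution the coefficient at i has order q v(a_i) - u (n - i), which is nonnegative by
    minimality and 0 at \<open>i0\<close>.\<close>
  define q where "q = n - i0"
  define u where "u = fls_subdegree (coeff F i0)"
  have q: "q > 0" using i0 by (auto simp: q_def I_def)
  interpret field_hom "\<lambda>a::'a fls. fls_compose_power a q" by (rule field_hom_compose_power[OF q])
  let ?X = "fls_X_intpow u :: 'a fls"
  \<comment> \<open>Division by t^(u n) makes the substituted polynomial monic again.\<close>
  define c where "c = inverse (?X ^ n)"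
  define B where "B = smult c (pcompose (map_poly (\<lambda>a. fls_compose_power a q) F) [:0, ?X:])"
  have c0: "c \<noteq> 0" by (simp add: c_def)
  have coeff_B: "coeff B i = c * (?X ^ i * fls_compose_power (coeff F i) q)" for i
    by (simp add: B_def coeff_pcompose_linear)
  have X: "?X ^ i \<noteq> 0" for i by simp
  have sub_B: "fls_subdegree (coeff B i) = int q * fls_subdegree (coeff F i) - u * (int n - int i)"
    if "coeff F i \<noteq> 0" for i
    using that q c0 X[of i] X[of n]
    by (simp add: coeff_B fls_subdegree_compose_power c_def fls_subdegree_pow algebra_simps)
  have deg_B: "degree B = n"
    using c0 by (simp add: B_def n_def degree_pcompose)
  have lead_B: "lead_coeff B = 1"
    using assms(1) X[of n] unfolding deg_B coeff_B by (simp add: c_def n_def)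
  have int: "fls_subdegree (coeff B i) \<ge> 0" for i
  proof (cases "i \<in> I")
    case True
    have "real_of_int u * real (n - i) \<le> real q * real_of_int (fls_subdegree (coeff F i))"
      using min[OF True] q True by (simp add: sl_def u_def q_def I_def field_simps)
    then have "u * int (n - i) \<le> int q * fls_subdegree (coeff F i)"
      by (metis (no_types, lifting) of_int_le_iff of_int_mult of_int_of_nat_eq)
    with True show ?thesis by (simp add: sub_B I_def of_nat_diff)
  next
    case False
    then consider "i = n" | "i > n" | "coeff F i = 0" by (force simp: I_def)
    then show ?thesis
    proof cases
      case 1 then show ?thesis using lead_B deg_B by simp
    next
      case 2 then show ?thesis using deg_B by (simp add: coeff_eq_0)
    qed (simp add: coeff_B)
  qed
  define b where "b = map_poly (\<lambda>a. fls_nth a 0) B"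
  have coeff_b: "coeff b i = fls_nth (coeff B i) 0" for i
    by (simp add: b_def coeff_map_poly)
  have deg_b: "degree b = n"
    using lead_B deg_B by (intro antisym degree_le le_degree) (auto simp: coeff_b coeff_eq_0)
  have "fls_subdegree (coeff B i0) = 0"
    using i0 by (simp add: sub_B I_def u_def q_def of_nat_diff)
  moreover have "coeff B i0 \<noteq> 0" using i0 c0 by (simp add: coeff_B I_def)
  ultimately have "coeff b i0 \<noteq> 0"
    by (metis coeff_b nth_fls_subdegree_nonzero)
  moreover have "lead_coeff b = 1" using lead_B deg_B deg_b by (simp add: coeff_b)
  moreover have "coeff b (degree b - 1) = 0"
    using assms(3) by (simp add: deg_b coeff_b coeff_B n_def)
  ultimately obtain x y where "x \<noteq> y" "poly b x = 0" "poly b y = 0"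
    using two_distinct_roots[of b i0] deg_b i0 assms(2) by (auto simp: I_def n_def)
  then obtain r s where rs: "degree r > 0" "degree s > 0" "coprime r s" "b = r * s"
    using alg_closed_imp_poly_splits_coprime[of b x y] deg_b assms(2) by (auto simp: n_def)
  obtain G H where "B = G * H" "degree G = degree r" "degree H = degree s"
    using hensel[OF int lead_B, of r s] rs by (auto simp: b_def)
  moreover have "degree r + degree s = n"
    using rs deg_b by (metis degree_mult_eq degree_0 less_irrefl)
  ultimately show ?thesis using q c0 rs
    by (intro exI[of _ q] exI[of _ u] exI[of _ c] exI[of _ G] exI[of _ H]) (auto simp: B_def n_def)
qed

text \<open>Induction on the degree. After a Tschirnhaus shift the polynomial is either y^n, with
  root 0, or the Newton step gives a factor of smaller positive degree at ramification q; a root of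
  that factor at ramification p is a root of the whole at ramification q p.\<close>

theorem puiseux_root_exists:
  fixes F :: "'a::{alg_closed_field, field_char_0} fls poly"
  assumes "degree F > 0"
  shows "\<exists>p>0. puiseux_roots p F \<noteq> {}"
  using assms
proof (induction "degree F" arbitrary: F rule: less_induct)
  case less
  define n where "n = degree F"
  obtain s where s: "coeff (pcompose F [:s, 1:]) (n - 1) = 0"
    using exists_shift_without_subleading[OF less.prems] by (auto simp: n_def)
  define P where "P = smult (inverse (lead_coeff F)) (pcompose F [:s, 1:])"
  have F0: "F \<noteq> 0" using less.prems by auto
  have deg_P: "degree P = n" using F0 by (simp add: P_def degree_pcompose n_def)
  have lead_P: "lead_coeff P = 1"
    using F0 lead_coeff_comp[of "[:s, 1:]" F] by (simp add: P_def)
  have P_imp: "puiseux_roots p F \<noteq> {}" if "p > 0" "poly (map_poly (\<lambda>a. fls_compose_power a p) P) z = 0" for p z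
  proof -
    interpret field_hom "\<lambda>a::'a fls. fls_compose_power a p" by (rule field_hom_compose_power[OF that(1)])
    have "poly (map_poly (\<lambda>a. fls_compose_power a p) F) (fls_compose_power s p + z) = 0"
      using that(2) F0 by (simp add: P_def map_poly_hom_smult map_poly_hom_pcompose poly_pcompose map_poly_hom_pCons)
    then show ?thesis by (auto simp: puiseux_roots_def)
  qed
  show ?case
  proof (cases "\<exists>i<n. coeff P i \<noteq> 0")
    case False
    have "poly P 0 = 0" using False less.prems by (simp add: poly_0_coeff_0 n_def)
    then have "puiseux_roots 1 F \<noteq> {}"
      by (intro P_imp[of 1 0]) simp_all
    then show ?thesis by (intro exI[of _ 1]) simp
  next
    case True
    then obtain i where i: "i < n" "coeff P i \<noteq> 0" by blast
    have sub: "coeff P (n - 1) = 0" using s by (simp add: P_def)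
    \<comment> \<open>For n = 1 the only lower coefficient is the subleading one, which the shift
      has made 0.\<close>
    have "n > 1" using i sub by (cases "n = 1") auto
    then obtain q u c G H where G: "q > 0" "c \<noteq> 0" "0 < degree G" "degree G < n"
      "G * H = smult c (pcompose (map_poly (\<lambda>a. fls_compose_power a q) P) [:0, fls_X_intpow u:])"
      using newton_slope_factor[of P i] lead_P sub i unfolding deg_P by blast
    obtain p z where p: "p > 0" "z \<in> puiseux_roots p G"
      using less.hyps[of G] G by (auto simp: n_def)
    interpret field_hom "\<lambda>a::'a fls. fls_compose_power a p" by (rule field_hom_compose_power[OF p(1)])
    have "map_poly (\<lambda>a. fls_compose_power a p) (map_poly (\<lambda>a. fls_compose_power a q) P) =
        map_poly (\<lambda>a. fls_compose_power a (q * p)) P"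
      using G(1) p(1) by (intro poly_eqI) (simp add: coeff_map_poly fls_compose_power_compose_power)
    moreover have "poly (map_poly (\<lambda>a. fls_compose_power a p) (G * H)) z = 0"
      using p(2) by (simp add: map_poly_hom_mult puiseux_roots_def)
    ultimately have "poly (map_poly (\<lambda>a. fls_compose_power a (q * p)) P) (z * fls_compose_power (fls_X_intpow u) p) = 0"
      using G(2) unfolding G(5) by (simp add: map_poly_hom_smult map_poly_hom_pcompose poly_pcompose map_poly_hom_pCons)
    then have "puiseux_roots (q * p) F \<noteq> {}"
      using G(1) p(1) by (intro P_imp[of "q * p"]) simp_all
    then show ?thesis using G(1) p(1) by (intro exI[of _ "q * p"]) simp
  qed
qed

section \<open>Newton's theorem and conjugation\<close>

lemma monic_irreducible_degree_pos: "monic_irreducible (F :: 'a::field fls poly) \<Longrightarrow> degree F > 0"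
  unfolding monic_irreducible_def irreducible_def
  by (metis gr0I is_unit_iff_degree)

lemma finite_puiseux_roots:
  assumes "F \<noteq> 0" "N > 0"
  shows "finite (puiseux_roots N (F :: 'a::field fls poly))"
  using poly_roots_finite[of "map_poly (\<lambda>a. fls_compose_power a N) F"] assms
    field_hom.map_poly_hom_eq_0_iff[OF field_hom_compose_power[OF assms(2)]]
  unfolding puiseux_roots_def by auto

text \<open>Otherwise the two polynomials are coprime, and a Bezout identity evaluated at the common
  root reads 0 = 1.\<close>

lemma irreducible_dvd_of_common_puiseux_root:
  fixes F G :: "'a::field fls poly"
  assumes "irreducible F" "N > 0" "y \<in> puiseux_roots N F" "y \<in> puiseux_roots N G"
  shows "F dvd G"
proof (rule ccontr)
  interpret field_hom "\<lambda>a::'a fls. fls_compose_power a N" by (rule field_hom_compose_power[OF assms(2)])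
  assume "\<not> F dvd G"
  then have "coprime F G"
    using assms(1) by (simp add: irreducible_imp_prime_elem_gcd prime_elem_imp_coprime)
  then obtain u v where "u * F + v * G = 1"
    using coprime_poly_bezout by blast
  then have "map_poly (\<lambda>a. fls_compose_power a N) (u * F + v * G) = 1"
    by (simp add: map_poly_hom_1)
  then have "poly (map_poly (\<lambda>a. fls_compose_power a N) (u * F + v * G)) y = 1" by simp
  then show False
    using assms(3,4) by (simp add: map_poly_hom_add map_poly_hom_mult puiseux_roots_def)
qed

lemma normalize_monic:
  assumes "lead_coeff p = 1"
  shows "normalize p = (p :: 'a::field fls poly)"
  using assms by (intro unit_factor_1_imp_normalized) (simp add: unit_factor_poly_def)

lemma monic_irreducible_eq_of_common_puiseux_root:
  fixes F G :: "'a::field fls poly"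
  assumes "monic_irreducible F" "monic_irreducible G" "N > 0"
    "y \<in> puiseux_roots N F" "y \<in> puiseux_roots N G"
  shows "F = G"
proof -
  have "F dvd G" "G dvd F"
    using assms irreducible_dvd_of_common_puiseux_root unfolding monic_irreducible_def by blast+
  moreover have "normalize F = F" "normalize G = G"
    using assms(1,2) by (simp_all only: normalize_monic monic_irreducible_def)
  ultimately show ?thesis by (rule associated_eqI)
qed

lemma degree_prod_linear: "degree (\<Prod>z\<in>A. [:- z, 1::'a::idom:]) = card A"
  by (simp add: degree_prod_sum_eq)

lemma lead_coeff_prod_linear: "lead_coeff (\<Prod>z\<in>A. [:- z, 1::'a::idom:]) = 1"
  by (simp add: lead_coeff_prod)

lemma prod_linear_dvd:
  assumes "finite A" "\<And>z. z \<in> A \<Longrightarrow> poly p z = 0"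
  shows "(\<Prod>z\<in>A. [:- z, 1::'a::field:]) dvd p"
  using assms
proof (induction A)
  case (insert z A)
  then obtain q where q: "p = (\<Prod>z\<in>A. [:- z, 1:]) * q" by (auto elim: dvdE)
  have "poly (\<Prod>z\<in>A. [:- z, 1:]) z \<noteq> 0"
    using insert.hyps by (auto simp: poly_prod)
  then have "poly q z = 0" using insert.prems[of z] q by simp
  then have "[:- z, 1:] dvd q" by (simp add: poly_eq_0_iff_dvd)
  then show ?case using insert.hyps q by (simp add: mult.commute mult_dvd_mono del: mult_pCons_left mult_pCons_right)
qed simp

lemma rot_puiseux_roots:
  assumes "w \<in> mu N" "N > 0" "y \<in> puiseux_roots N F"
  shows "rot w y \<in> puiseux_roots N F"
proof -
  have w0: "w \<noteq> 0" using assms mu_nonzero by blast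
  interpret field_hom "rot w" by (rule field_hom_rot[OF w0])
  have "map_poly (rot w) (map_poly (\<lambda>a. fls_compose_power a N) F) = map_poly (\<lambda>a. fls_compose_power a N) F"
    using rot_compose_power[OF assms(1,2)] by (intro poly_eqI) (simp add: coeff_map_poly)
  then show ?thesis
    using poly_hom[of "map_poly (\<lambda>a. fls_compose_power a N) F" y] assms(3)
    by (simp add: puiseux_roots_def)
qed

lemma rot_orbit_eq:
  fixes w :: "'a::field"
  assumes "w \<in> mu N" "N > 0"
  shows "rot w ` (\<lambda>v. rot v y) ` mu N = (\<lambda>v. rot v y) ` mu N"
proof -
  have w0: "w \<noteq> 0" using assms mu_nonzero by blast
  have "rot w (rot v y) = rot (w * v) y" if "v \<in> mu N" for v :: 'a
    using w0 mu_nonzero[OF assms(2) that] by (rule rot_rot)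
  moreover have "(\<lambda>v. w * v) ` mu N = mu N"
  proof
    show "mu N \<subseteq> (\<lambda>v. w * v) ` mu N"
    proof
      fix v :: 'a assume "v \<in> mu N"
      then have "inverse w * v \<in> mu N" using assms(1) by (intro mu_mult mu_inverse)
      moreover have "v = w * (inverse w * v)" using w0 by simp
      ultimately show "v \<in> (\<lambda>v. w * v) ` mu N" by blast
    qed
  qed (use mu_mult[OF assms(1)] in auto)
  moreover have "rot w ` (\<lambda>v. rot v y) ` mu N = (\<lambda>v. rot v y) ` (\<lambda>v. w * v) ` mu N"
    unfolding image_image by (intro image_cong) (simp_all add: calculation(1))
  ultimately show ?thesis by simp
qed

text \<open>The product \<open>P\<close> of linear factors over the orbit of \<open>y\<close> is
  invariant under all rotations, so it has coefficients in K((x)) and is divisible by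
  \<open>F\<close>. Hence deg F \<le> orbit size \<le> number of roots \<le> deg F, and equality
  holds throughout.\<close>

theorem puiseux_roots_conj:
  fixes F :: "'a::{alg_closed_field, field_char_0} fls poly"
  assumes F: "monic_irreducible F" and N: "N > 0" and y: "y \<in> puiseux_roots N F"
  shows "puiseux_roots N F = (\<lambda>w. rot w y) ` mu N" and
    "card (puiseux_roots N F) = degree F" and
    "map_poly (\<lambda>a. fls_compose_power a N) F = (\<Prod>z\<in>puiseux_roots N F. [:- z, 1:])"
proof -
  interpret field_hom "\<lambda>a::'a fls. fls_compose_power a N" by (rule field_hom_compose_power[OF N])
  let ?F = "map_poly (\<lambda>a. fls_compose_power a N) F"
  define C where "C = (\<lambda>w. rot w y) ` mu N"
  define P where "P = (\<Prod>z\<in>C. [:- z, 1:])"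
  have F0: "F \<noteq> 0" using F by (auto simp: monic_irreducible_def)
  have fin: "finite C" unfolding C_def by (intro finite_imageI card_mu(2)[OF N])
  have C_sub: "C \<subseteq> puiseux_roots N F"
    using rot_puiseux_roots[OF _ N y] by (auto simp: C_def)
  have yC: "y \<in> C" unfolding C_def by (rule image_eqI[of _ _ 1]) auto
  have inv: "map_poly (rot w) P = P" if w: "w \<in> mu N" for w
  proof -
    have w0: "w \<noteq> 0" using w N mu_nonzero by blast
    interpret r: field_hom "rot w" by (rule field_hom_rot[OF w0])
    have "map_poly (rot w) P = (\<Prod>z\<in>C. [:- rot w z, 1:])"
      by (simp add: P_def r.map_poly_hom_prod r.map_poly_hom_linear)
    also have "\<dots> = (\<Prod>z\<in>rot w ` C. [:- z, 1:])"
      by (rule prod.reindex_cong[symmetric, OF inj_onI]) auto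
    also have "rot w ` C = C" unfolding C_def by (rule rot_orbit_eq[OF w N])
    finally show ?thesis by (simp add: P_def)
  qed
  have "\<exists>b. coeff P i = fls_compose_power b N" for i
  proof (rule ex_compose_power[OF N])
    fix j assume j: "fls_nth (coeff P i) j \<noteq> 0"
    show "int N dvd j"
    proof (rule mu_all_powi_imp_dvd[OF N])
      fix w :: 'a assume w: "w \<in> mu N"
      have w0: "w \<noteq> 0" using w N mu_nonzero by blast
      interpret r: field_hom "rot w" by (rule field_hom_rot[OF w0])
      have "rot w (coeff P i) = coeff P i" using inv[OF w] by (metis r.coeff_hom)
      then have "fls_nth (coeff P i) j * w powi j = fls_nth (coeff P i) j"
        by (metis fls_nth_rot w0)
      with j show "w powi j = 1" by simp
    qed
  qed
  then obtain b where b: "\<And>i. coeff P i = fls_compose_power (b i) N" by metis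
  \<comment> \<open>\<open>G\<close> is the descent of \<open>P\<close> to K((x)): the polynomial
    whose coefficients become those of \<open>P\<close> at ramification \<open>N\<close>.\<close>
  define G where "G = (\<Sum>i\<le>degree P. monom (b i) i)"
  have "map_poly (\<lambda>a. fls_compose_power a N) G = P"
  proof (rule poly_eqI)
    fix i
    have "b i = 0" if "i > degree P"
      using b[of i] that by (simp add: coeff_eq_0)
    then have "coeff G i = b i"
      by (cases "i \<le> degree P") (auto simp: G_def coeff_sum)
    then show "coeff (map_poly (\<lambda>a. fls_compose_power a N) G) i = coeff P i" using b by simp
  qed
  then have G: "map_poly (\<lambda>a. fls_compose_power a N) G = P" .
  have "poly P y = 0" using fin yC by (auto simp: P_def poly_prod)
  then have "F dvd G"
    using F y N by (intro irreducible_dvd_of_common_puiseux_root[of F N y])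
      (auto simp: monic_irreducible_def puiseux_roots_def G)
  moreover have "G \<noteq> 0" using G lead_coeff_prod_linear[of C] by (auto simp: P_def)
  ultimately have "degree F \<le> degree G" by (intro dvd_imp_degree_le)
  also have "degree G = card C" using arg_cong[OF G, of degree] by (simp add: P_def degree_prod_linear)
  finally have 1: "degree F \<le> card C" .
  have 2: "card C \<le> card (puiseux_roots N F)"
    by (rule card_mono[OF finite_puiseux_roots[OF F0 N] C_sub])
  have 3: "card (puiseux_roots N F) \<le> degree F"
    using card_poly_roots_bound[of ?F] F0 by (simp add: puiseux_roots_def)
  show card: "card (puiseux_roots N F) = degree F" using 1 2 3 by simp
  show "puiseux_roots N F = (\<lambda>w. rot w y) ` mu N"
    using card_subset_eq[OF finite_puiseux_roots[OF F0 N] C_sub] 1 2 3 by (simp add: C_def)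
  have "(\<Prod>z\<in>puiseux_roots N F. [:- z, 1:]) dvd ?F"
    by (rule prod_linear_dvd[OF finite_puiseux_roots[OF F0 N]]) (simp add: puiseux_roots_def)
  then obtain q where q: "?F = (\<Prod>z\<in>puiseux_roots N F. [:- z, 1:]) * q" by (elim dvdE)
  then have "q \<noteq> 0" using F0 by auto
  have "degree ?F = card (puiseux_roots N F) + degree q"
    unfolding q using \<open>q \<noteq> 0\<close> finite_puiseux_roots[OF F0 N]
    by (subst degree_mult_eq) (auto simp: degree_prod_linear)
  then have "degree q = 0" using card by simp
  moreover have "lead_coeff ?F = lead_coeff q"
    unfolding q by (simp only: lead_coeff_mult lead_coeff_prod_linear mult_1)
  then have "lead_coeff q = 1" using F by (simp add: monic_irreducible_def)
  ultimately have "q = 1" by (metis degree_eq_zeroE lead_coeff_pCons(2) one_pCons coeff_pCons_0)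
  with q show "?F = (\<Prod>z\<in>puiseux_roots N F. [:- z, 1:])" by simp
qed

text \<open>From a root at some ramification p, divide out the common divisor d of p and all
  exponents. At the remaining index e = p / d the e rotations of the root are distinct, and they are
  all the roots, so e = deg F. This shows that the choice in \<open>newton_root\<close> is made from
  a nonempty set.\<close>

theorem newton_puiseux:
  fixes F :: "'a::{alg_closed_field, field_char_0} fls poly"
  assumes F: "monic_irreducible F"
  shows "newton_root F \<in> puiseux_roots (degree F) F"
proof -
  have dF: "degree F > 0" using F by (rule monic_irreducible_degree_pos)
  obtain p y where p: "p > 0" and y: "y \<in> puiseux_roots p F"
    using puiseux_root_exists[OF dF] by blast
  \<comment> \<open>Including \<open>p\<close> makes the gcd \<open>d\<close> a divisor of
    \<open>p\<close>, and positive.\<close>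
  define S where "S = insert (int p) {i. fls_nth y i \<noteq> 0}"
  define d where "d = nat (Gcd S)"
  have d: "int d = Gcd S" by (simp add: d_def)
  have "int d dvd int p" unfolding d by (rule Gcd_dvd) (simp add: S_def)
  then have dp: "d dvd p" by simp
  then have d0: "d > 0" using p by (auto intro: Nat.gr0I)
  have "\<exists>z. y = fls_compose_power z d"
  proof (rule ex_compose_power[OF d0])
    fix i assume "fls_nth y i \<noteq> 0"
    then show "int d dvd i" unfolding d by (intro Gcd_dvd) (simp add: S_def)
  qed
  then obtain z where z: "y = fls_compose_power z d" by blast
  obtain e where e: "p = e * d" using dp by (metis dvdE mult.commute)
  have e0: "e > 0" using p e by (auto intro: Nat.gr0I)
  interpret field_hom "\<lambda>a::'a fls. fls_compose_power a d" by (rule field_hom_compose_power[OF d0])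
  have "map_poly (\<lambda>a. fls_compose_power a d) (map_poly (\<lambda>a. fls_compose_power a e) F) =
      map_poly (\<lambda>a. fls_compose_power a p) F"
    using e0 d0 e by (intro poly_eqI) (simp add: coeff_map_poly fls_compose_power_compose_power)
  then have "fls_compose_power (poly (map_poly (\<lambda>a. fls_compose_power a e) F) z) d = 0"
    using y poly_hom[of "map_poly (\<lambda>a. fls_compose_power a e) F" z]
    by (simp add: z puiseux_roots_def)
  then have ze: "z \<in> puiseux_roots e F" by (simp add: puiseux_roots_def)
  have "inj_on (\<lambda>w. rot w z) (mu e)"
  proof (rule inj_onI)
    fix v w assume vw: "v \<in> mu e" "w \<in> mu e" "rot v z = rot w z"
    have nz: "v \<noteq> 0" "w \<noteq> 0" using vw e0 mu_nonzero by blast+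
    define u where "u = v * inverse w"
    have u: "u \<in> mu e" unfolding u_def using vw by (intro mu_mult mu_inverse)
    obtain m where m0: "m > 0" and m: "\<And>i. u powi i = 1 \<longleftrightarrow> int m dvd i" using mu_order[OF u e0] by blast
    \<comment> \<open>The order \<open>m\<close> of the quotient of two rotations with the same
      effect divides e and the support of \<open>z\<close>. Thus \<open>m * d\<close> divides all of
      \<open>S\<close>, and maximality of the gcd gives m = 1.\<close>
    have "int (m * d) dvd i" if "i \<in> S" for i
    proof (cases "i = int p")
      case True
      have "int m dvd int e" using m[of "int e"] u by (simp add: mu_def)
      then show ?thesis using True e by simp
    next
      case False
      then have "fls_nth (fls_compose_power z d) i \<noteq> 0" using that z by (simp add: S_def)
      then obtain k where k: "i = int d * k" "fls_nth z k \<noteq> 0"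
        using d0 by (auto simp: fls_nth_compose_power split: if_splits)
      have "fls_nth z k * v powi k = fls_nth z k * w powi k"
        using arg_cong[OF vw(3), of "\<lambda>a. fls_nth a k"] nz by (simp add: fls_nth_rot)
      then have "u powi k = 1"
        using k nz by (simp add: u_def power_int_mult_distrib power_int_inverse)
      then show ?thesis using m[of k] k by simp
    qed
    then have "int (m * d) dvd int d" unfolding d by (rule Gcd_greatest)
    then have "m * d \<le> d" using d0 by (intro dvd_imp_le) (simp_all only: int_dvd_int_iff)
    then have "m = 1" using d0 m0 by simp
    then have "u = 1" using m[of 1] by simp
    then show "v = w" using nz by (simp add: u_def field_simps)
  qed
  then have "card (puiseux_roots e F) = e"
    using puiseux_roots_conj(1)[OF F e0 ze] card_mu(1)[OF e0] by (simp add: card_image)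
  then have "e = degree F" using puiseux_roots_conj(2)[OF F e0 ze] by simp
  with ze have "z \<in> puiseux_roots (degree F) F" by simp
  then show ?thesis unfolding newton_root_def by (rule someI)
qed

text \<open>A finer ramification brings no new roots: by conjugacy both sets have exactly deg F
  elements.\<close>

lemma puiseux_roots_mult:
  fixes F :: "'a::{alg_closed_field, field_char_0} fls poly"
  assumes F: "monic_irreducible F" and mk: "m * k > 0" and ne: "puiseux_roots m F \<noteq> {}"
  shows "puiseux_roots (m * k) F = (\<lambda>y. fls_compose_power y k) ` puiseux_roots m F"
proof -
  have m: "m > 0" and k: "k > 0" using mk by auto
  interpret field_hom "\<lambda>a::'a fls. fls_compose_power a k" by (rule field_hom_compose_power[OF k])
  have "map_poly (\<lambda>a. fls_compose_power a k) (map_poly (\<lambda>a. fls_compose_power a m) F) =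
      map_poly (\<lambda>a. fls_compose_power a (m * k)) F"
    using m k by (intro poly_eqI) (simp add: coeff_map_poly fls_compose_power_compose_power)
  then have sub: "(\<lambda>y. fls_compose_power y k) ` puiseux_roots m F \<subseteq> puiseux_roots (m * k) F"
    using poly_hom[of "map_poly (\<lambda>a. fls_compose_power a m) F"]
    by (auto simp: puiseux_roots_def)
  obtain y where y: "y \<in> puiseux_roots m F" using ne by blast
  have "card ((\<lambda>y. fls_compose_power y k) ` puiseux_roots m F) = degree F"
    using puiseux_roots_conj(2)[OF F m y] by (subst card_image) (auto intro: inj_onI)
  moreover have "card (puiseux_roots (m * k) F) = degree F"
    using puiseux_roots_conj(2)[OF F mk] sub y by blast
  moreover have "finite (puiseux_roots (m * k) F)"
    using F by (intro finite_puiseux_roots mk) (auto simp: monic_irreducible_def)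
  ultimately show ?thesis using card_subset_eq[OF _ sub] by simp
qed

lemma puiseux_roots_nonempty:
  fixes F :: "'a::{alg_closed_field, field_char_0} fls poly"
  assumes F: "monic_irreducible F" and "degree F dvd N" "N > 0"
  shows "puiseux_roots N F \<noteq> {}"
proof -
  have ne: "puiseux_roots (degree F) F \<noteq> {}" using newton_puiseux[OF F] by blast
  obtain k where "N = degree F * k" using assms by blast
  then show ?thesis using puiseux_roots_mult[OF F _ ne, of k] assms ne by simp
qed

section \<open>Characteristic sequences\<close>

lemma Inf_int_mem:
  fixes X :: "int set"
  assumes "X \<noteq> {}" "\<And>x. x \<in> X \<Longrightarrow> b \<le> x"
  shows "Inf X \<in> X"
proof -
  obtain x where x: "x \<in> X" "\<And>z. z \<in> X \<Longrightarrow> nat (x - b) \<le> nat (z - b)"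
    using assms(1) ex_has_least_nat[of "\<lambda>x. x \<in> X" _ "\<lambda>x. nat (x - b)"] by blast
  have "x \<le> z" if "z \<in> X" for z
    using x(2)[OF that] assms(2)[OF that] assms(2)[OF x(1)] by linarith
  with x(1) have "Inf X = x" by (intro cInf_eq_minimum)
  with x(1) show ?thesis by simp
qed

lemma supp_ge: "i \<in> supp F \<Longrightarrow> fls_subdegree (newton_root F) \<le> i"
  by (auto simp: supp_def intro: fls_subdegree_leI)

lemma char_m_le: "i \<in> supp F \<Longrightarrow> \<not> int (char_d F k) dvd i \<Longrightarrow> char_m F k \<le> i"
  unfolding char_m_def by (rule cInf_lower) (auto intro!: bdd_belowI[of _ "fls_subdegree (newton_root F)"] supp_ge)

lemma char_d_Suc: "k \<ge> 1 \<Longrightarrow> int (char_d F (Suc k)) = gcd (int (char_d F k)) (char_m F k)"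
  by (cases k) (simp_all add: char_m_def)

lemma char_d_pos: "degree F > 0 \<Longrightarrow> char_d F k > 0"
proof (induction k)
  case (Suc k)
  show ?case
  proof (cases "k = 0")
    case False
    then have "int (char_d F (Suc k)) \<noteq> 0" using Suc by (subst char_d_Suc) auto
    then show ?thesis by simp
  qed (use Suc in simp)
qed simp

lemma char_d_dvd:
  assumes "1 \<le> j" "j \<le> k"
  shows "char_d F k dvd char_d F j"
  using assms(2)
proof (induction k rule: dec_induct)
  case (step k)
  have "int (char_d F (Suc k)) dvd int (char_d F k)" using step assms by (subst char_d_Suc) auto
  then have "char_d F (Suc k) dvd char_d F k" by (simp only: int_dvd_int_iff)
  then show ?case using step.IH by (rule dvd_trans)
qed simp

context
  fixes F :: "'a::{alg_closed_field, field_char_0} fls poly"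
  assumes F: "monic_irreducible F"
begin

lemma degree_pos: "degree F > 0"
  using F by (rule monic_irreducible_degree_pos)

text \<open>The orbit map goes from the n elements of \<open>mu n\<close> onto the n roots, where n
  = deg F.\<close>

lemma inj_on_rot_newton_root: "inj_on (\<lambda>w. rot w (newton_root F)) (mu (degree F))"
  using puiseux_roots_conj(1,2)[OF F degree_pos newton_puiseux[OF F]] card_mu[where 'a = 'a, OF degree_pos]
  by (intro eq_card_imp_inj_on) simp_all

lemma eq_1_if_powi_supp:
  fixes w :: 'a
  assumes "w \<in> mu (degree F)" "\<And>i. i \<in> supp F \<Longrightarrow> w powi i = 1"
  shows "w = 1"
proof -
  have w0: "w \<noteq> 0" using assms(1) mu_nonzero[OF degree_pos] by blast
  have "rot w (newton_root F) = rot 1 (newton_root F)"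
    using assms(2) by (intro fls_eqI) (auto simp: fls_nth_rot w0 supp_def)
  then show ?thesis using inj_onD[OF inj_on_rot_newton_root, of w 1] assms(1) by simp
qed

text \<open>The infimum must be over a nonempty set. If \<open>d_k\<close> divided the whole
  support, a nontrivial \<open>d_k\<close>-th root of unity would fix the Newton root, against the
  injectivity of the action.\<close>

lemma char_m_mem:
  assumes "k \<ge> 1" "char_d F k > 1"
  shows "char_m F k \<in> supp F" "\<not> int (char_d F k) dvd char_m F k"
proof -
  have "\<exists>i\<in>supp F. \<not> int (char_d F k) dvd i"
  proof (rule ccontr)
    assume *: "\<not> ?thesis"
    have "card (mu (char_d F k) :: 'a set) > 1" using card_mu(1)[where 'a = 'a, of "char_d F k"] assms by simp
    then have "\<not> (mu (char_d F k) :: 'a set) \<subseteq> {1}"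
      using card_mono[of "{1::'a}" "mu (char_d F k)"] by auto
    then obtain w :: 'a where w: "w \<in> mu (char_d F k)" "w \<noteq> 1" by blast
    have "char_d F k dvd degree F" using char_d_dvd[of 1 k F] assms by simp
    then have "w \<in> mu (degree F)" using w mu_dvd by blast
    moreover have "w powi i = 1" if "i \<in> supp F" for i
      using * that w by (auto simp: mu_def power_int_mult elim!: dvdE)
    ultimately show False using eq_1_if_powi_supp w by blast
  qed
  then have "char_m F k \<in> {i \<in> supp F. \<not> int (char_d F k) dvd i}"
    unfolding char_m_def by (intro Inf_int_mem[of _ "fls_subdegree (newton_root F)"]) (auto intro: supp_ge)
  then show "char_m F k \<in> supp F" "\<not> int (char_d F k) dvd char_m F k" by auto
qed

text \<open>As long as \<open>d_k > 1\<close>, the exponent \<open>m_k\<close> is not divisible by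
  \<open>d_k\<close>, so the sequence of divisors strictly decreases and must reach 1.\<close>

lemma char_d_h: "char_d F (Suc (char_h F)) = 1"
proof -
  have "\<exists>k. char_d F (Suc k) = 1"
  proof (rule ccontr)
    assume *: "\<not> ?thesis"
    have gt: "char_d F (Suc k) > 1" for k
      using * char_d_pos[OF degree_pos, of "Suc k"] by (metis One_nat_def Suc_lessI)
    \<comment> \<open>Each step lowers the divisor by at least 1; at k = deg F this leaves no room
      for a positive value.\<close>
    have "char_d F (Suc k) + k \<le> degree F" for k
    proof (induction k)
      case (Suc k)
      have "char_d F (Suc (Suc k)) dvd char_d F (Suc k)" by (rule char_d_dvd) simp_all
      then have "char_d F (Suc (Suc k)) \<le> char_d F (Suc k)" using gt[of k] by (intro dvd_imp_le) linarith+
      moreover have "char_d F (Suc (Suc k)) \<noteq> char_d F (Suc k)"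
        using char_m_mem(2)[of "Suc k"] gt[of k] char_d_Suc[of "Suc k" F] by (metis gcd_dvd2 le_add1 plus_1_eq_Suc)
      ultimately show ?case using Suc by linarith
    qed simp
    from this[of "degree F"] gt[of "degree F"] show False by simp
  qed
  then show ?thesis unfolding char_h_def by (rule LeastI_ex)
qed

lemma char_d_gt_1: "1 \<le> k \<Longrightarrow> k \<le> char_h F \<Longrightarrow> char_d F k > 1"
  using not_less_Least[of "k - 1" "\<lambda>h. char_d F (Suc h) = 1"] char_d_pos[OF degree_pos, of k]
  unfolding char_h_def[symmetric] by (cases k) auto

lemma char_h_eq_0: "char_h F = 0 \<Longrightarrow> degree F = 1"
  using char_d_h by simp

text \<open>An exponent of the support below \<open>m_k\<close> is divisible by \<open>d_k\<close>,
  and \<open>m_k\<close> itself is divisible by \<open>d_(k+1)\<close>. So every exponent up to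
  \<open>m_k\<close> is divisible by \<open>d_(k+1)\<close>, which \<open>m_(k+1)\<close> is
  not.\<close>

lemma char_m_Suc:
  assumes "1 \<le> k" "Suc k \<le> char_h F"
  shows "char_m F k < char_m F (Suc k)"
proof (rule ccontr)
  assume *: "\<not> ?thesis"
  have m: "char_m F (Suc k) \<in> supp F" "\<not> int (char_d F (Suc k)) dvd char_m F (Suc k)"
    using char_m_mem[of "Suc k"] char_d_gt_1[of "Suc k"] assms by auto
  have d: "int (char_d F (Suc k)) dvd int (char_d F k)" "int (char_d F (Suc k)) dvd char_m F k"
    using assms by (simp_all add: char_d_Suc del: char_d.simps)
  show False
  proof (cases "char_m F (Suc k) = char_m F k")
    case False
    with * m(1) have "int (char_d F k) dvd char_m F (Suc k)"
      using char_m_le[of "char_m F (Suc k)" F k] by fastforce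
    with d m show False by (metis dvd_trans)
  qed (use d m in auto)
qed

lemma char_m_less: "1 \<le> j \<Longrightarrow> j < k \<Longrightarrow> k \<le> char_h F \<Longrightarrow> char_m F j < char_m F k"
proof (induction k)
  case (Suc k)
  then show ?case using char_m_Suc[of k] by (cases "j = k") auto
qed simp

lemma char_ratio_less: "1 \<le> j \<Longrightarrow> j < k \<Longrightarrow> k \<le> char_h F \<Longrightarrow> char_ratio F j < char_ratio F k"
  using char_m_less degree_pos by (simp add: char_ratio_def divide_strict_right_mono)

text \<open>The order of \<open>w\<close> divides deg F and each \<open>m_j\<close> with j < h,
  hence the successive gcds up to \<open>d_h\<close>.\<close>

lemma order_dvd_char_d:
  assumes "w \<in> mu (degree F)" "\<And>i. w powi i = 1 \<longleftrightarrow> int e dvd i"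
    and "\<And>i. i \<in> supp F \<Longrightarrow> i < char_m F (char_h F) \<Longrightarrow> w powi i = 1"
    and "1 \<le> k" "k \<le> char_h F"
  shows "e dvd char_d F k"
  using assms(4,5)
proof (induction k rule: dec_induct)
  case base
  have "w powi int (degree F) = 1" using assms(1) by (simp add: mu_def)
  then show ?case using assms(2)[of "int (degree F)"] by simp
next
  case (step k)
  have "char_m F k \<in> supp F" "char_m F k < char_m F (char_h F)"
    using step char_m_mem[of k] char_d_gt_1[of k] char_m_less[of k "char_h F"] by auto
  then have "int e dvd char_m F k" using assms(2,3) by blast
  moreover have "int e dvd int (char_d F k)" using step by simp
  ultimately have "int e dvd int (char_d F (Suc k))" using step by (subst char_d_Suc) auto
  then show ?case by simp
qed

text \<open>One direction is the divisibility of \<open>d_h\<close> by the order of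
  \<open>w\<close>. For the other, minimality of \<open>m_h\<close> makes every earlier exponent of
  the support a multiple of \<open>d_h\<close>.\<close>

lemma powi_supp_less_iff:
  assumes "char_h F \<ge> 1" "w \<in> mu (degree F)"
  shows "(\<forall>i\<in>supp F. i < char_m F (char_h F) \<longrightarrow> w powi i = 1) \<longleftrightarrow> w \<in> mu (char_d F (char_h F))"
proof
  obtain e where e: "\<And>i. w powi i = 1 \<longleftrightarrow> int e dvd i" using mu_order[OF assms(2) degree_pos] by blast
  {
    assume "\<forall>i\<in>supp F. i < char_m F (char_h F) \<longrightarrow> w powi i = 1"
    then have "e dvd char_d F (char_h F)"
      using assms by (intro order_dvd_char_d[OF assms(2) e]) auto
    then show "w \<in> mu (char_d F (char_h F))" using e[of "int (char_d F (char_h F))"] by (simp add: mu_def)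
  next
    assume "w \<in> mu (char_d F (char_h F))"
    then have "e dvd char_d F (char_h F)" using e[of "int (char_d F (char_h F))"] by (simp add: mu_def)
    moreover have "int (char_d F (char_h F)) dvd i" if "i \<in> supp F" "i < char_m F (char_h F)" for i
      using char_m_le[of i F "char_h F"] that by fastforce
    ultimately show "\<forall>i\<in>supp F. i < char_m F (char_h F) \<longrightarrow> w powi i = 1"
      using e by (meson dvd_trans int_dvd_int_iff)
  }
qed

text \<open>Including the exponent \<open>m_h\<close> makes the order of \<open>w\<close> divide
  gcd(d_h, m_h) = d_(h+1) = 1.\<close>

lemma eq_1_if_powi_supp_le:
  assumes "char_h F \<ge> 1" "w \<in> mu (degree F)" "\<And>i. i \<in> supp F \<Longrightarrow> i \<le> char_m F (char_h F) \<Longrightarrow> w powi i = 1"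
  shows "w = 1"
proof -
  obtain e where e: "\<And>i. w powi i = 1 \<longleftrightarrow> int e dvd i" using mu_order[OF assms(2) degree_pos] by blast
  have "e dvd char_d F (char_h F)"
    using assms by (intro order_dvd_char_d[OF assms(2) e]) auto
  moreover have "int e dvd char_m F (char_h F)"
    using assms char_m_mem[of "char_h F"] char_d_gt_1[of "char_h F"] e by auto
  ultimately have "int e dvd int (char_d F (Suc (char_h F)))"
    using assms(1) by (subst char_d_Suc) auto
  then show ?thesis using char_d_h e[of 1] by simp
qed

end

section \<open>Orders of differences of conjugate roots\<close>

lemma puiseux_order_ge_iff:
  assumes "n > 0"
  shows "puiseux_order n a \<ge> ereal (real_of_int m / real n) \<longleftrightarrow> (\<forall>i<m. fls_nth a i = 0)"
proof (cases "a = 0")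
  case False
  have "puiseux_order n a \<ge> ereal (real_of_int m / real n) \<longleftrightarrow> m \<le> fls_subdegree a"
    using False assms by (simp add: puiseux_order_def field_simps)
  also have "\<dots> \<longleftrightarrow> (\<forall>i<m. fls_nth a i = 0)"
    using False by (auto intro: fls_subdegree_geI)
  finally show ?thesis .
qed (simp add: puiseux_order_def)

lemma puiseux_order_gt_iff:
  assumes "n > 0"
  shows "puiseux_order n a > ereal (real_of_int m / real n) \<longleftrightarrow> (\<forall>i\<le>m. fls_nth a i = 0)"
proof (cases "a = 0")
  case False
  have "puiseux_order n a > ereal (real_of_int m / real n) \<longleftrightarrow> m < fls_subdegree a"
    using False assms by (simp add: puiseux_order_def field_simps)
  also have "\<dots> \<longleftrightarrow> (\<forall>i\<le>m. fls_nth a i = 0)"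
    using False by (auto intro: fls_subdegree_greaterI)
  finally show ?thesis .
qed (simp add: puiseux_order_def)

text \<open>Chooses an arbitrary root \<open>y\<close> as base point: \<open>y\<close> is a rotation
  by some \<open>v\<close> of the Newton root, and \<open>g w\<close> applies the rotation by
  \<open>w\<close> before that by \<open>v\<close>. Neither the rotation by \<open>v\<close> nor the
  change of ramification affects orders.\<close>

lemma puiseux_roots_param:
  fixes F :: "'a::{alg_closed_field, field_char_0} fls poly"
  assumes F: "monic_irreducible F" and N: "N = degree F * k" "N > 0" and y: "y \<in> puiseux_roots N F"
  obtains g where "bij_betw g (mu (degree F)) (puiseux_roots N F)" "g 1 = y"
    "\<And>w. w \<in> mu (degree F) \<Longrightarrow>
      puiseux_order N (g w - y) = puiseux_order (degree F) (rot w (newton_root F) - newton_root F)"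
proof -
  let ?n = "degree F" and ?y = "newton_root F"
  have k: "k > 0" and n: "?n > 0" using N by auto
  interpret field_hom "\<lambda>a::'a fls. fls_compose_power a k" by (rule field_hom_compose_power[OF k])
  have R: "puiseux_roots N F = (\<lambda>y. fls_compose_power y k) ` (\<lambda>w. rot w ?y) ` mu ?n"
    using puiseux_roots_mult[OF F, of "degree F" k] N newton_puiseux[OF F]
      puiseux_roots_conj(1)[OF F n newton_puiseux[OF F]] by auto
  then obtain v where v: "v \<in> mu ?n" "y = fls_compose_power (rot v ?y) k" using y by auto
  have v0: "v \<noteq> 0" using v mu_nonzero n by blast
  interpret r: field_hom "rot v" by (rule field_hom_rot[OF v0])
  define g where "g = (\<lambda>w. fls_compose_power (rot v (rot w ?y)) k)"
  have inj: "inj_on g (mu ?n)"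
    using inj_on_rot_newton_root[OF F] by (auto simp: g_def inj_on_def)
  have "g ` mu ?n = (\<lambda>y. fls_compose_power y k) ` rot v ` (\<lambda>w. rot w ?y) ` mu ?n"
    by (simp add: g_def image_image)
  also have "\<dots> = puiseux_roots N F" unfolding R rot_orbit_eq[OF v(1) n] ..
  finally have "bij_betw g (mu ?n) (puiseux_roots N F)" using inj by (simp add: bij_betw_def)
  moreover have "g 1 = y" by (simp add: g_def v)
  moreover have "puiseux_order N (g w - y) = puiseux_order ?n (rot w ?y - ?y)" for w
  proof -
    have "g w - y = fls_compose_power (rot v (rot w ?y - ?y)) k"
      by (simp add: g_def v r.hom_diff)
    then show ?thesis using puiseux_order_compose_power[OF k n] N puiseux_order_rot[OF v0] by metis
  qed
  ultimately show thesis by (rule that)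
qed

text \<open>The coefficient of \<open>rot w y - y\<close> at i is (w^i - 1) times that of y, so high
  order means w^i = 1 on an initial part of the support.\<close>

lemma conj_order_ge_iff:
  fixes F :: "'a::{alg_closed_field, field_char_0} fls poly"
  assumes F: "monic_irreducible F" and h: "char_h F \<ge> 1" and w: "w \<in> mu (degree F)"
  shows "puiseux_order (degree F) (rot w (newton_root F) - newton_root F) \<ge> char_ratio F (char_h F)
      \<longleftrightarrow> w \<in> mu (char_d F (char_h F))"
proof -
  have w0: "w \<noteq> 0" using w mu_nonzero[OF degree_pos[OF F]] by blast
  have "puiseux_order (degree F) (rot w (newton_root F) - newton_root F) \<ge> char_ratio F (char_h F) \<longleftrightarrow>
    (\<forall>i\<in>supp F. i < char_m F (char_h F) \<longrightarrow> w powi i = 1)"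
    unfolding char_ratio_def puiseux_order_ge_iff[OF degree_pos[OF F]] by (auto simp: fls_nth_rot w0 supp_def)
  then show ?thesis using powi_supp_less_iff[OF F h w] by simp
qed

lemma conj_order_le:
  fixes F :: "'a::{alg_closed_field, field_char_0} fls poly"
  assumes F: "monic_irreducible F" and h: "char_h F \<ge> 1" and w: "w \<in> mu (degree F)" "w \<noteq> 1"
  shows "puiseux_order (degree F) (rot w (newton_root F) - newton_root F) \<le> char_ratio F (char_h F)"
proof (rule ccontr)
  have w0: "w \<noteq> 0" using w mu_nonzero[OF degree_pos[OF F]] by blast
  assume "\<not> ?thesis"
  then have "\<forall>i\<in>supp F. i \<le> char_m F (char_h F) \<longrightarrow> w powi i = 1"
    unfolding char_ratio_def not_le puiseux_order_gt_iff[OF degree_pos[OF F]]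
    by (auto simp: fls_nth_rot w0 supp_def)
  then show False using eq_1_if_powi_supp_le[OF F h w(1)] w(2) by blast
qed

lemma roots_apart_of_gt_last_exponent:
  fixes F :: "'a::{alg_closed_field, field_char_0} fls poly"
  assumes F: "monic_irreducible F" and N: "degree F dvd N" "N > 0"
    and y: "y \<in> puiseux_roots N F" "z \<in> puiseux_roots N F" "y \<noteq> z" and M: "gt_last_exponent M F"
  shows "puiseux_order N (z - y) < M"
proof -
  obtain k where "N = degree F * k" using N by blast
  then obtain g where g: "bij_betw g (mu (degree F)) (puiseux_roots N F)" "g 1 = y"
    "\<And>w. w \<in> mu (degree F) \<Longrightarrow>
      puiseux_order N (g w - y) = puiseux_order (degree F) (rot w (newton_root F) - newton_root F)"
    using puiseux_roots_param[OF F _ N(2) y(1)] by blast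
  obtain w where w: "w \<in> mu (degree F)" "z = g w"
    using g(1) y(2) by (auto simp: bij_betw_def)
  have "w \<noteq> 1" using w g y by auto
  have "char_h F \<noteq> 0"
  proof
    assume "char_h F = 0"
    then have "degree F = 1" by (rule char_h_eq_0[OF F])
    then show False using w \<open>w \<noteq> 1\<close> by (simp add: mu_def)
  qed
  then show ?thesis
    using conj_order_le[OF F _ w(1) \<open>w \<noteq> 1\<close>] g(3)[OF w(1)] M w(2) by (simp add: gt_last_exponent_def)
qed

text \<open>Relative to \<open>y\<close> the roots are indexed by \<open>mu n\<close>, n = deg F;
  those agreeing with \<open>y\<close> up to the last characteristic exponent are indexed by the
  subgroup \<open>mu d_h\<close>.\<close>

lemma roots_apart_of_eq_last_exponent:
  fixes F :: "'a::{alg_closed_field, field_char_0} fls poly"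
  assumes F: "monic_irreducible F" and N: "degree F dvd N" "N > 0"
    and y: "y \<in> puiseux_roots N F" and M: "eq_last_exponent M F"
  shows "z \<in> puiseux_roots N F \<Longrightarrow> y \<noteq> z \<Longrightarrow> puiseux_order N (z - y) \<le> M"
    and "card {z \<in> puiseux_roots N F. puiseux_order N (z - y) \<ge> M} = char_d F (char_h F)"
proof -
  obtain k where "N = degree F * k" using N by blast
  then obtain g where g: "bij_betw g (mu (degree F)) (puiseux_roots N F)" "g 1 = y"
    "\<And>w. w \<in> mu (degree F) \<Longrightarrow>
      puiseux_order N (g w - y) = puiseux_order (degree F) (rot w (newton_root F) - newton_root F)"
    using puiseux_roots_param[OF F _ N(2) y(1)] by blast
  have h: "char_h F \<ge> 1" and M: "M = char_ratio F (char_h F)" using M by (auto simp: eq_last_exponent_def)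
  show "puiseux_order N (z - y) \<le> M" if z: "z \<in> puiseux_roots N F" "y \<noteq> z"
  proof -
    obtain w where w: "w \<in> mu (degree F)" "z = g w"
      using g(1) z(1) by (auto simp: bij_betw_def)
    have "w \<noteq> 1" using w g z by auto
    then show ?thesis using conj_order_le[OF F h w(1)] g(3)[OF w(1)] M w(2) by simp
  qed
  have sub: "mu (char_d F (char_h F)) \<subseteq> (mu (degree F) :: 'a set)"
    using char_d_dvd[of 1 "char_h F" F] h by (intro mu_dvd) simp
  have "{z \<in> puiseux_roots N F. puiseux_order N (z - y) \<ge> M} = g ` {w \<in> mu (degree F). puiseux_order N (g w - y) \<ge> M}"
    using g(1) by (auto simp: bij_betw_def)
  also have "{w \<in> mu (degree F). puiseux_order N (g w - y) \<ge> M} = mu (char_d F (char_h F))"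
    using conj_order_ge_iff[OF F h] g(3) M sub by auto
  also have "card (g ` mu (char_d F (char_h F))) = card (mu (char_d F (char_h F)) :: 'a set)"
    by (rule card_image) (rule inj_on_subset[OF bij_betw_imp_inj_on[OF g(1)] sub])
  also have "\<dots> = char_d F (char_h F)"
    by (rule card_mu(1)) (rule char_d_pos[OF degree_pos[OF F]])
  finally show "card {z \<in> puiseux_roots N F. puiseux_order N (z - y) \<ge> M} = char_d F (char_h F)" .
qed

text \<open>The quotient \<open>d_(k+1) / n\<close> depends only on the ratios
  \<open>m_j / n\<close> with j \<le> k, because gcds scale; cross-multiplication keeps the argument
  in the integers.\<close>

lemma char_d_proportional:
  fixes F G :: "'a::{alg_closed_field, field_char_0} fls poly"
  assumes F: "monic_irreducible F" and G: "monic_irreducible G"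
    and ratio: "\<And>j. 1 \<le> j \<Longrightarrow> j \<le> k \<Longrightarrow> char_ratio F j = char_ratio G j"
  shows "char_d F (Suc k) * degree G = char_d G (Suc k) * degree F"
  using ratio
proof (induction k)
  case (Suc k)
  have n: "degree F > 0" "degree G > 0" using F G monic_irreducible_degree_pos by auto
  have "char_ratio F (Suc k) = char_ratio G (Suc k)" using Suc.prems by simp
  then have "real_of_int (char_m F (Suc k)) * real (degree G) = real_of_int (char_m G (Suc k)) * real (degree F)"
    using n by (simp add: char_ratio_def field_simps)
  then have m: "char_m F (Suc k) * int (degree G) = char_m G (Suc k) * int (degree F)"
    by (metis of_int_eq_iff of_int_mult of_int_of_nat_eq)
  have d: "int (char_d F (Suc k)) * int (degree G) = int (char_d G (Suc k)) * int (degree F)"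
    using Suc by (metis le_Suc_eq of_nat_mult)
  have dist: "gcd a b * int c = gcd (a * int c) (b * int c)" for a b :: int and c
    using gcd_mult_distrib_int[of "int c" a b] by (simp add: mult.commute)
  have "int (char_d F (Suc (Suc k))) * int (degree G) =
      gcd (int (char_d F (Suc k)) * int (degree G)) (char_m F (Suc k) * int (degree G))"
    by (simp add: char_d_Suc dist del: char_d.simps)
  also have "\<dots> = int (char_d G (Suc (Suc k))) * int (degree F)"
    unfolding m d by (simp add: char_d_Suc dist del: char_d.simps)
  finally show ?case by (metis of_nat_eq_iff of_nat_mult)
qed simp

section \<open>Counting roots in balls\<close>

text \<open>A non-archimedean absolute value with residue characteristic 0. The assumption on
  positive integers is the point where characteristic 0 enters the count: differentiation does not
  shrink coefficients.\<close>

locale nonarch =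
  fixes v :: "'a::field \<Rightarrow> real"
  assumes v_0 [simp]: "v 0 = 0"
    and v_pos: "x \<noteq> 0 \<Longrightarrow> v x > 0"
    and v_mult: "v (x * y) = v x * v y"
    and v_add: "v (x + y) \<le> max (v x) (v y)"
    and v_of_nat: "n > 0 \<Longrightarrow> v (of_nat n) = 1"
begin

lemma v_nonneg [simp]: "v x \<ge> 0"
  using v_pos[of x] by (cases "x = 0") auto

lemma v_1 [simp]: "v 1 = 1"
  using v_of_nat[of 1] by simp

lemma v_uminus [simp]: "v (- x) = v x"
proof -
  have "v (- 1) * v (- 1) = 1" using v_mult[of "- 1" "- 1"] by simp
  then have "v (- 1) = 1" using v_nonneg[of "-1"] by (metis abs_of_nonneg real_sqrt_abs2 real_sqrt_one)
  then show ?thesis using v_mult[of "- 1" x] by simp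
qed

lemma v_sum_less:
  assumes "finite A" "\<And>a. a \<in> A \<Longrightarrow> v (f a) < V" "V > 0"
  shows "v (sum f A) < V"
  using assms
proof (induction A)
  case (insert a A)
  then show ?case using v_add[of "f a" "sum f A"] by fastforce
qed simp

lemma v_add_eq: "v y < v x \<Longrightarrow> v (x + y) = v x"
  using v_add[of x y] v_add[of "x + y" "- y"] by (auto simp: max_def split: if_splits)

text \<open>
  \<open>d\<close> is the right end of the edge of the Newton polygon of \<open>p\<close> on which the radius \<open>\<rho>\<close> lies, which
  is the number of roots of \<open>p\<close> in the closed ball of radius \<open>\<rho>\<close> around \<open>0\<close>.
\<close>
definition dominant :: "real \<Rightarrow> 'a poly \<Rightarrow> nat \<Rightarrow> bool" where
  "dominant \<rho> p d \<longleftrightarrow> (\<exists>V>0. v (coeff p d) * \<rho> ^ d = V \<and>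
     (\<forall>i. v (coeff p i) * \<rho> ^ i \<le> V) \<and> (\<forall>i>d. v (coeff p i) * \<rho> ^ i < V))"

lemma dominant_unique: "dominant \<rho> p d \<Longrightarrow> dominant \<rho> p e \<Longrightarrow> d = e"
  unfolding dominant_def by (metis linorder_neqE_nat not_le)

text \<open>A form of Gauss's lemma with weights. In the coefficient at \<open>d + e\<close> exactly
  one product reaches the maximal size \<open>V * W\<close>, so nothing cancels it; beyond
  \<open>d + e\<close> every product is strictly smaller.\<close>

lemma dominant_mult:
  assumes \<rho>: "\<rho> > 0" and p: "dominant \<rho> p d" and q: "dominant \<rho> q e"
  shows "dominant \<rho> (p * q) (d + e)"
proof -
  define a where "a = (\<lambda>i. v (coeff p i) * \<rho> ^ i)"
  define b where "b = (\<lambda>i. v (coeff q i) * \<rho> ^ i)"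
  obtain V where V: "V > 0" "a d = V" "\<And>i. a i \<le> V" "\<And>i. i > d \<Longrightarrow> a i < V"
    using p unfolding dominant_def a_def by blast
  obtain W where W: "W > 0" "b e = W" "\<And>i. b i \<le> W" "\<And>i. i > e \<Longrightarrow> b i < W"
    using q unfolding dominant_def b_def by blast
  have ab0: "a i \<ge> 0" "b i \<ge> 0" for i using \<rho> by (simp_all add: a_def b_def)
  have tm: "v (coeff p i * coeff q (k - i)) * \<rho> ^ k = a i * b (k - i)" if "i \<le> k" for i k
    using that by (simp add: a_def b_def v_mult mult_ac flip: power_add)
  have strict: "a i * b j < V * W" if "i > d \<or> j > e" for i j
    using that
  proof
    assume "i > d"
    have "a i * b j \<le> a i * W" using W(3) ab0 by (intro mult_left_mono) auto
    also have "\<dots> < V * W" using V(4)[OF \<open>i > d\<close>] W(1) by simp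
    finally show ?thesis .
  next
    assume "j > e"
    have "a i * b j \<le> V * b j" using V(3) ab0 by (intro mult_right_mono) auto
    also have "\<dots> < V * W" using W(4)[OF \<open>j > e\<close>] V(1) by simp
    finally show ?thesis .
  qed
  have le: "a i * b j \<le> V * W" for i j
    using V(3) W(3) ab0 by (intro mult_mono') auto
  have sum_less: "v (\<Sum>i\<in>A. coeff p i * coeff q (k - i)) * \<rho> ^ k < V * W"
    if "A \<subseteq> {..k}" "\<And>i. i \<in> A \<Longrightarrow> i > d \<or> k - i > e" for A k
  proof -
    have "v (\<Sum>i\<in>A. coeff p i * coeff q (k - i)) < V * W / \<rho> ^ k"
    proof (rule v_sum_less)
      show "finite A" using that finite_subset by blast
      show "V * W / \<rho> ^ k > 0" using V W \<rho> by simp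
      fix i assume "i \<in> A"
      then show "v (coeff p i * coeff q (k - i)) < V * W / \<rho> ^ k"
        using tm[of i k] strict[of i "k - i"] that \<rho> by (auto simp: pos_less_divide_eq)
    qed
    then show ?thesis using \<rho> by (simp add: pos_less_divide_eq)
  qed
  have gt: "v (coeff (p * q) k) * \<rho> ^ k < V * W" if "k > d + e" for k
    unfolding coeff_mult using that by (intro sum_less) auto
  have leq: "v (coeff (p * q) k) * \<rho> ^ k \<le> V * W" for k
  proof -
    have "v (\<Sum>i\<in>A. coeff p i * coeff q (k - i)) \<le> V * W / \<rho> ^ k" if "A \<subseteq> {..k}" for A
      using finite_subset[OF that finite_atMost] that
    proof (induction A)
      case (insert i A)
      have "v (coeff p i * coeff q (k - i)) \<le> V * W / \<rho> ^ k"
        using tm[of i k] le[of i "k - i"] insert.prems \<rho> by (auto simp: pos_le_divide_eq)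
      with insert show ?case
        using v_add[of "coeff p i * coeff q (k - i)" "\<Sum>i\<in>A. coeff p i * coeff q (k - i)"] by fastforce
    qed (use V W \<rho> in simp)
    from this[of "{..k}"] show ?thesis using \<rho> by (simp add: coeff_mult pos_le_divide_eq)
  qed
  have "v (coeff (p * q) (d + e)) * \<rho> ^ (d + e) = V * W"
  proof -
    define x where "x = coeff p d * coeff q e"
    \<comment> \<open>For every index i other than \<open>d\<close>, either i > d or the
      complementary index exceeds \<open>e\<close>, so this remainder is strictly smaller than the
      term split off.\<close>
    define y where "y = (\<Sum>i\<in>{..d + e} - {d}. coeff p i * coeff q (d + e - i))"
    have xy: "coeff (p * q) (d + e) = x + y"
      unfolding coeff_mult x_def y_def by (subst sum.remove[of _ d]) auto
    have x: "v x * \<rho> ^ (d + e) = V * W"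
      using tm[of d "d + e"] V(2) W(2) by (simp add: x_def)
    have "v y * \<rho> ^ (d + e) < V * W"
      unfolding y_def by (intro sum_less) auto
    then have "v y < v x" using \<rho> unfolding x[symmetric] by simp
    then show ?thesis unfolding xy using x by (simp add: v_add_eq)
  qed
  with gt leq V(1) W(1) show ?thesis unfolding dominant_def
    by (intro exI[of _ "V * W"] conjI allI impI) simp_all
qed

lemma dominant_const: "c \<noteq> 0 \<Longrightarrow> dominant \<rho> [:c:] 0"
  using v_pos[of c] unfolding dominant_def by (intro exI[of _ "v c"]) (auto simp: coeff_pCons split: nat.splits)

text \<open>In the tie \<open>v z = \<rho>\<close> the larger index is taken, which is why closed
  balls are counted.\<close>

lemma dominant_linear:
  assumes "\<rho> > 0"
  shows "dominant \<rho> [:- z, 1:] (if v z \<le> \<rho> then 1 else 0)"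
  unfolding dominant_def using assms
  by (intro exI[of _ "max (v z) \<rho>"]) (auto simp: coeff_pCons max_def split: nat.splits)

lemma dominant_power: "\<rho> > 0 \<Longrightarrow> dominant \<rho> p d \<Longrightarrow> dominant \<rho> (p ^ n) (n * d)"
  by (induction n) (use dominant_const[of 1] dominant_mult in \<open>auto simp: one_pCons\<close>)

lemma dominant_prod:
  assumes "\<rho> > 0" "finite A" "\<And>a. a \<in> A \<Longrightarrow> dominant \<rho> (f a) (d a)"
  shows "dominant \<rho> (prod f A) (sum d A)"
  using assms(2,3)
  by (induction A) (use dominant_const[of 1] dominant_mult assms(1) in \<open>auto simp: one_pCons\<close>)

text \<open>The factors i + 1 brought by differentiation have absolute value 1, so the weighted
  sizes are only shifted by one index and divided by \<open>\<rho>\<close>.\<close>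

lemma dominant_pderiv:
  assumes "\<rho> > 0" "dominant \<rho> p (Suc d)"
  shows "dominant \<rho> (pderiv p) d"
proof -
  have *: "v (coeff (pderiv p) i) * \<rho> ^ i = (v (coeff p (Suc i)) * \<rho> ^ Suc i) / \<rho>" for i
    using assms(1) v_of_nat[of "Suc i"] by (simp add: coeff_pderiv v_mult)
  obtain V where V: "V > 0" "v (coeff p (Suc d)) * \<rho> ^ Suc d = V" "\<And>i. v (coeff p i) * \<rho> ^ i \<le> V"
    "\<And>i. i > Suc d \<Longrightarrow> v (coeff p i) * \<rho> ^ i < V"
    using assms(2) unfolding dominant_def by blast
  show ?thesis
    unfolding dominant_def *
  proof (intro exI[of _ "V / \<rho>"] conjI allI impI)
    fix i
    show "v (coeff p (Suc i)) * \<rho> ^ Suc i / \<rho> \<le> V / \<rho>"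
      by (rule divide_right_mono[OF V(3)]) (use assms(1) in simp)
    show "v (coeff p (Suc i)) * \<rho> ^ Suc i / \<rho> < V / \<rho>" if "i > d"
      by (rule divide_strict_right_mono[OF V(4)]) (use assms(1) that in simp_all)
  qed (use V(1,2) assms(1) in simp_all)
qed

end

section \<open>The t-adic absolute value and the order in x\<close>

definition fls_abs :: "'a::field_char_0 fls \<Rightarrow> real" where
  "fls_abs a = (if a = 0 then 0 else 2 powr (- real_of_int (fls_subdegree a)))"

lemma nonarch_fls_abs: "nonarch (fls_abs :: 'a::field_char_0 fls \<Rightarrow> real)"
proof
  fix x y :: "'a fls"
  show "fls_abs (x * y) = fls_abs x * fls_abs y"
    by (auto simp: fls_abs_def powr_add[symmetric])
  show "fls_abs (x + y) \<le> max (fls_abs x) (fls_abs y)"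
  proof (cases "x = 0 \<or> y = 0 \<or> x + y = 0")
    case False
    then have "fls_subdegree (x + y) \<ge> min (fls_subdegree x) (fls_subdegree y)"
      by (intro fls_plus_subdegree) auto
    then show ?thesis using False by (auto simp: fls_abs_def le_max_iff_disj)
  qed (auto simp: fls_abs_def max_def)
next
  fix n :: nat assume "n > 0"
  have "(of_nat n :: 'a fls) = fls_const (of_nat n)" by (simp add: fls_of_nat)
  then show "fls_abs (of_nat n :: 'a fls) = 1"
    using \<open>n > 0\<close> by (simp add: fls_abs_def)
qed (auto simp: fls_abs_def)

text \<open>As t has order 1/n in x, order \<open>m\<close> in x means order \<open>m n\<close> in
  t, hence the radius.\<close>

lemma fls_abs_le_iff:
  assumes "n > 0"
  shows "fls_abs a \<le> 2 powr (- m * real n) \<longleftrightarrow> puiseux_order n a \<ge> ereal m"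
  using assms by (simp add: fls_abs_def puiseux_order_def field_simps)

lemma puiseux_order_add:
  assumes "n > 0"
  shows "puiseux_order n (a + b) \<ge> min (puiseux_order n a) (puiseux_order n (b :: 'a::field fls))"
proof (cases "a = 0 \<or> b = 0 \<or> a + b = 0")
  case False
  then have "fls_subdegree (a + b) \<ge> min (fls_subdegree a) (fls_subdegree b)"
    by (intro fls_plus_subdegree) auto
  with False assms show ?thesis
    by (auto simp: puiseux_order_def min_def divide_le_cancel split: if_splits)
qed (auto simp: puiseux_order_def min_def)

lemma puiseux_order_minus: "puiseux_order n (a - b) = puiseux_order n (b - (a :: 'a::field fls))"
  by (simp add: puiseux_order_def fls_subdegree_minus_sym)

lemma puiseux_order_trans:
  assumes "n > 0" "puiseux_order n (a - b) \<ge> M" "puiseux_order n (b - c) \<ge> M"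
  shows "puiseux_order n (a - (c :: 'a::field fls)) \<ge> M"
  using puiseux_order_add[OF assms(1), of "a - b" "b - c"] assms(2,3) by (auto simp: min_def split: if_splits)

section \<open>Irreducible components and contact\<close>

text \<open>Monic is the normal form of a polynomial over a field, so monic irreducible means
  normalized prime; the factorization theory of factorial rings then applies.\<close>

lemma components_eq_prime_factors:
  fixes H :: "'a::field fls poly"
  assumes "H \<noteq> 0"
  shows "components H = prime_factors H"
proof -
  have "monic_irreducible g \<longleftrightarrow> prime g" for g :: "'a fls poly"
  proof
    assume g: "monic_irreducible g"
    then have "normalize g = g" by (intro normalize_monic) (simp add: monic_irreducible_def)
    moreover have "prime_elem g"
      using g by (intro irreducible_imp_prime_elem_gcd) (simp add: monic_irreducible_def)
    ultimately show "prime g" by (simp add: prime_def)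
  next
    assume g: "prime g"
    then have "g \<noteq> 0" "unit_factor g = 1" by (auto simp: unit_factor_prime)
    then have "lead_coeff g = 1" by (simp add: unit_factor_poly_def monom_0 one_pCons)
    moreover have "irreducible g" using g by (intro prime_elem_imp_irreducible) simp
    ultimately show "monic_irreducible g" by (simp add: monic_irreducible_def)
  qed
  then show ?thesis using assms by (auto simp: components_def in_prime_factors_iff)
qed

lemma factorization_components:
  fixes H :: "'a::field fls poly"
  assumes "H \<noteq> 0"
  shows "\<exists>c. c \<noteq> 0 \<and> H = smult c (\<Prod>g\<in>components H. g ^ multiplicity g H)"
proof -
  have "(\<Prod>g\<in>components H. g ^ multiplicity g H) = normalize H"
    using assms by (simp add: components_eq_prime_factors prod_prime_factors)
  then have "H = unit_factor H * (\<Prod>g\<in>components H. g ^ multiplicity g H)" by simp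
  moreover have "unit_factor H = [:lead_coeff H:]"
    using assms by (simp add: unit_factor_poly_def monom_0)
  ultimately show ?thesis using assms by (intro exI[of _ "lead_coeff H"]) auto
qed

lemma multiplicity_component_pos:
  assumes "H \<noteq> 0" "g \<in> components (H :: 'a::field fls poly)"
  shows "multiplicity g H > 0"
  using assms by (simp add: components_eq_prime_factors prime_factors_multiplicity)

text \<open>The roots of \<open>F\<close> in a closed ball around \<open>y\<close>, which may be any
  series and not only a root of \<open>F\<close>.\<close>

definition near :: "nat \<Rightarrow> ereal \<Rightarrow> 'a::field fls poly \<Rightarrow> 'a fls \<Rightarrow> 'a fls set" where
  "near N M F y = {z \<in> puiseux_roots N F. puiseux_order N (z - y) \<ge> M}"

text \<open>In an ultrametric space every point of a ball is a centre of it.\<close>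

lemma near_cong:
  assumes "N > 0" "puiseux_order N (x - y) \<ge> M"
  shows "near N M F x = near N M F y"
proof -
  have "puiseux_order N (z - x) \<ge> M \<longleftrightarrow> puiseux_order N (z - y) \<ge> M" for z
    using assms puiseux_order_trans[of N M z x y] puiseux_order_trans[of N M z y x] puiseux_order_minus[of N x y]
    by auto
  then show ?thesis by (simp add: near_def)
qed

lemma pcompose_power: "pcompose (p ^ n) q = pcompose p q ^ n"
  by (induction n) (simp_all add: pcompose_mult pcompose_1)

text \<open>After translation of the centre to 0, each linear factor contributes 1 or 0 according to
  whether its root lies in the ball, and dominant indices add up over products.\<close>

lemma dominant_components:
  fixes H :: "'a::{alg_closed_field, field_char_0} fls poly"
  assumes H: "H \<noteq> 0" and N: "N > 0" "\<And>g. g \<in> components H \<Longrightarrow> degree g dvd N"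
  shows "nonarch.dominant fls_abs (2 powr (- m * real N))
    (pcompose (map_poly (\<lambda>a. fls_compose_power a N) H) [:c, 1:])
    (\<Sum>g\<in>components H. multiplicity g H * card (near N (ereal m) g c))"
proof -
  interpret nonarch "fls_abs :: 'a fls \<Rightarrow> real" by (rule nonarch_fls_abs)
  interpret field_hom "\<lambda>a::'a fls. fls_compose_power a N" by (rule field_hom_compose_power[OF N(1)])
  let ?\<rho> = "2 powr (- m * real N) :: real"
  have \<rho>: "?\<rho> > 0" by simp
  obtain b where b: "b \<noteq> 0" "H = smult b (\<Prod>g\<in>components H. g ^ multiplicity g H)"
    using factorization_components[OF H] by blast
  have fin: "finite (components H)" using H by (simp add: components_eq_prime_factors)
  have dom: "dominant ?\<rho> (pcompose (map_poly (\<lambda>a. fls_compose_power a N) g) [:c, 1:])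
      (card (near N (ereal m) g c))" if g: "g \<in> components H" for g
  proof -
    have mi: "monic_irreducible g" using g by (simp add: components_def)
    obtain y where y: "y \<in> puiseux_roots N g"
      using puiseux_roots_nonempty[OF mi N(2)[OF g] N(1)] by blast
    have finR: "finite (puiseux_roots N g)"
      using mi by (intro finite_puiseux_roots N) (auto simp: monic_irreducible_def)
    have "pcompose (map_poly (\<lambda>a. fls_compose_power a N) g) [:c, 1:] = (\<Prod>z\<in>puiseux_roots N g. [:- (z - c), 1:])"
      unfolding puiseux_roots_conj(3)[OF mi N(1) y] by (simp add: pcompose_prod pcompose_pCons)
    moreover have "dominant ?\<rho> \<dots> (\<Sum>z\<in>puiseux_roots N g. if fls_abs (z - c) \<le> ?\<rho> then 1 else 0)"
      by (intro dominant_prod dominant_linear \<rho> finR)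
    moreover have "(\<Sum>z\<in>puiseux_roots N g. if fls_abs (z - c) \<le> ?\<rho> then 1 else 0) = card (near N (ereal m) g c)"
      using finR unfolding fls_abs_le_iff[OF N(1)] by (simp add: near_def sum.If_cases Int_def)
    ultimately show ?thesis by simp
  qed
  have "map_poly (\<lambda>a. fls_compose_power a N) H = smult (fls_compose_power b N)
      (\<Prod>g\<in>components H. map_poly (\<lambda>a. fls_compose_power a N) g ^ multiplicity g H)"
    by (subst b(2)) (simp only: map_poly_hom_smult map_poly_hom_prod map_poly_hom_power)
  then have "pcompose (map_poly (\<lambda>a. fls_compose_power a N) H) [:c, 1:] = [:fls_compose_power b N:] *
      (\<Prod>g\<in>components H. pcompose (map_poly (\<lambda>a. fls_compose_power a N) g) [:c, 1:] ^ multiplicity g H)"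
    by (simp add: pcompose_smult pcompose_prod pcompose_power)
  moreover have "dominant ?\<rho> \<dots> (0 + (\<Sum>g\<in>components H. multiplicity g H * card (near N (ereal m) g c)))"
    using b(1) by (intro dominant_mult dominant_const dominant_prod dominant_power \<rho> fin dom) auto
  ultimately show ?thesis by simp
qed

text \<open>A non-archimedean Rolle theorem: the number of roots in the ball is the dominant index,
  it drops by one under differentiation, and it is determined by the polynomial. The form
  \<open>Suc d\<close> records that the ball contains a root of \<open>f\<close>.\<close>

lemma rolle_count:
  fixes f :: "'a::{alg_closed_field, field_char_0} fls poly"
  assumes f: "pderiv f \<noteq> 0" and N: "N > 0" "\<And>g. g \<in> components f \<union> components (pderiv f) \<Longrightarrow> degree g dvd N"
    and d: "(\<Sum>g\<in>components f. multiplicity g f * card (near N (ereal m) g c)) = Suc d"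
  shows "(\<Sum>g\<in>components (pderiv f). multiplicity g (pderiv f) * card (near N (ereal m) g c)) = d"
proof -
  interpret nonarch "fls_abs :: 'a fls \<Rightarrow> real" by (rule nonarch_fls_abs)
  interpret field_hom "\<lambda>a::'a fls. fls_compose_power a N" by (rule field_hom_compose_power[OF N(1)])
  let ?\<rho> = "2 powr (- m * real N) :: real"
  let ?f = "pcompose (map_poly (\<lambda>a. fls_compose_power a N) f) [:c, 1:]"
  have "f \<noteq> 0" using f by auto
  then have "dominant ?\<rho> ?f (Suc d)"
    using dominant_components[of f N m c] N d by simp
  then have "dominant ?\<rho> (pderiv ?f) d" by (intro dominant_pderiv) auto
  moreover have "pderiv ?f = pcompose (map_poly (\<lambda>a. fls_compose_power a N) (pderiv f)) [:c, 1:]"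
    by (simp add: pderiv_pcompose map_poly_hom_pderiv pderiv_pCons)
  ultimately show ?thesis
    using dominant_unique dominant_components[OF f N(1), of m c] N by simp
qed

section \<open>Properties of the contact\<close>

text \<open>The maximum in \<open>contact\<close> runs over all pairs of roots, but conjugation
  carries any root of \<open>F\<close> to the given \<open>y\<close> and preserves orders, so one
  root can be held fixed.\<close>

lemma contact_iff:
  fixes F G :: "'a::{alg_closed_field, field_char_0} fls poly"
  assumes F: "monic_irreducible F" and G: "monic_irreducible G"
    and N: "degree F * degree G dvd N" "N > 0" and y: "y \<in> puiseux_roots N F"
  shows "contact F G \<ge> M \<longleftrightarrow> (\<exists>z\<in>puiseux_roots N G. puiseux_order N (z - y) \<ge> M)" (is ?ge)
    and "contact F G > M \<longleftrightarrow> (\<exists>z\<in>puiseux_roots N G. puiseux_order N (z - y) > M)" (is ?gt)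
proof -
  define p where "p = degree F * degree G"
  obtain k where k: "N = p * k" using N by (auto simp: p_def)
  have p: "p > 0" and k0: "k > 0" using k N(2) by auto
  interpret field_hom "\<lambda>a::'a fls. fls_compose_power a k" by (rule field_hom_compose_power[OF k0])
  have lift: "puiseux_roots N E = (\<lambda>y. fls_compose_power y k) ` puiseux_roots p E"
    if E: "monic_irreducible E" "degree E dvd p" for E :: "'a fls poly"
    unfolding k using N(2) k by (intro puiseux_roots_mult puiseux_roots_nonempty E p) simp
  have fin: "finite (puiseux_roots N E)" if "monic_irreducible E" for E :: "'a fls poly"
    using that N by (intro finite_puiseux_roots) (auto simp: monic_irreducible_def)
  let ?X = "(\<lambda>(y, z). puiseux_order N (y - z)) ` (puiseux_roots N F \<times> puiseux_roots N G)"
  have X: "{puiseux_order p (y - z) | y z. y \<in> puiseux_roots p F \<and> z \<in> puiseux_roots p G} = ?X"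
  proof -
    have "puiseux_order N (fls_compose_power y k - fls_compose_power z k) = puiseux_order p (y - z)" for y z :: "'a fls"
      using puiseux_order_compose_power[OF k0 p, of "y - z"] by (simp add: hom_diff k)
    then show ?thesis using lift[OF F] lift[OF G] by (auto simp: p_def image_iff; blast)
  qed
  have ne: "puiseux_roots N G \<noteq> {}"
    using G N by (intro puiseux_roots_nonempty) (auto elim: dvd_mult_right)
  have finX: "finite ?X" using fin F G by auto
  have neX: "?X \<noteq> {}" using y ne by auto
  have contact: "contact F G = Max ?X" unfolding contact_def Let_def p_def[symmetric] X ..
  have conj: "\<exists>z'\<in>puiseux_roots N G. puiseux_order N (z' - y) = puiseux_order N (x - z)"
    if x: "x \<in> puiseux_roots N F" and z: "z \<in> puiseux_roots N G" for x z
  proof -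
    obtain w where w: "w \<in> mu N" "y = rot w x"
      using y puiseux_roots_conj(1)[OF F N(2) x] by auto
    have w0: "w \<noteq> 0" using w mu_nonzero N by blast
    interpret r: field_hom "rot w" by (rule field_hom_rot[OF w0])
    have "rot w z \<in> puiseux_roots N G" by (rule rot_puiseux_roots[OF w(1) N(2) z])
    moreover have "puiseux_order N (rot w z - y) = puiseux_order N (x - z)"
      using puiseux_order_rot[OF w0, of N "z - x"] w(2) puiseux_order_minus[of N z x] by (simp add: r.hom_diff)
    ultimately show ?thesis by blast
  qed
  have "(\<exists>x\<in>?X. Q x) \<longleftrightarrow> (\<exists>z\<in>puiseux_roots N G. Q (puiseux_order N (z - y)))" for Q
  proof
    assume "\<exists>x\<in>?X. Q x"
    then obtain x z where "x \<in> puiseux_roots N F" "z \<in> puiseux_roots N G" "Q (puiseux_order N (x - z))"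
      by auto
    with conj[of x z] show "\<exists>z\<in>puiseux_roots N G. Q (puiseux_order N (z - y))" by metis
  next
    assume "\<exists>z\<in>puiseux_roots N G. Q (puiseux_order N (z - y))"
    then obtain z where "z \<in> puiseux_roots N G" "Q (puiseux_order N (y - z))"
      unfolding puiseux_order_minus[of N _ y] by blast
    with y show "\<exists>x\<in>?X. Q x" by auto
  qed
  then show ?ge ?gt
    unfolding contact Max_ge_iff[OF finX neX] Max_gr_iff[OF finX neX] by this+
qed

lemma contact_commute:
  fixes F G :: "'a::{alg_closed_field, field_char_0} fls poly"
  assumes F: "monic_irreducible F" and G: "monic_irreducible G"
  shows "contact F G = contact G F"
proof -
  have "{puiseux_order p (y - z) | y z. y \<in> A \<and> z \<in> B} = {puiseux_order p (y - z) | y z. y \<in> B \<and> z \<in> A}"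
    for p and A B :: "'a fls set"
    using puiseux_order_minus by blast
  then show ?thesis by (simp add: contact_def mult.commute[of "degree F"])
qed

text \<open>At a common ramification index, start from one root of \<open>F\<close> and choose a
  close root of \<open>G\<close>, then of \<open>H\<close>; the ultrametric inequality compares the
  ends.\<close>

lemma contact_trans:
  fixes F G H :: "'a::{alg_closed_field, field_char_0} fls poly"
  assumes F: "monic_irreducible F" and G: "monic_irreducible G" and H: "monic_irreducible H"
    and M: "contact F G \<ge> M" "contact G H \<ge> M"
  shows "contact F H \<ge> M"
proof -
  define N where "N = degree F * degree G * degree H"
  have N: "N > 0" using F G H by (simp add: N_def monic_irreducible_degree_pos)
  have dvd: "degree F * degree G dvd N" "degree G * degree H dvd N" "degree F * degree H dvd N" "degree F dvd N"
    by (simp_all add: N_def)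
  obtain x where x: "x \<in> puiseux_roots N F" using puiseux_roots_nonempty[OF F dvd(4) N] by blast
  obtain y where y: "y \<in> puiseux_roots N G" "puiseux_order N (y - x) \<ge> M"
    using contact_iff(1)[OF F G dvd(1) N x] M(1) by blast
  obtain z where z: "z \<in> puiseux_roots N H" "puiseux_order N (z - y) \<ge> M"
    using contact_iff(1)[OF G H dvd(2) N y(1)] M(2) by blast
  show ?thesis
    using contact_iff(1)[OF F H dvd(3) N x] puiseux_order_trans[OF N z(2) y(2)] z(1) by blast
qed

text \<open>Infinite contact would mean a common root, and so equality of the two
  polynomials.\<close>

lemma contact_real:
  fixes F G :: "'a::{alg_closed_field, field_char_0} fls poly"
  assumes F: "monic_irreducible F" and G: "monic_irreducible G" and "F \<noteq> G"
  shows "\<exists>m. contact F G = ereal m"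
proof -
  define N where "N = degree F * degree G"
  have N: "N > 0" using F G by (simp add: N_def monic_irreducible_degree_pos)
  have dvd: "degree F * degree G dvd N" "degree F dvd N" "degree G dvd N" by (simp_all add: N_def)
  obtain x where x: "x \<in> puiseux_roots N F" using puiseux_roots_nonempty[OF F dvd(2) N] by blast
  obtain y where y: "y \<in> puiseux_roots N G" using puiseux_roots_nonempty[OF G dvd(3) N] by blast
  have "contact F G > -\<infinity>"
    unfolding contact_iff(2)[OF F G dvd(1) N x] using y by (auto simp: puiseux_order_def intro!: bexI[of _ y])
  moreover have "\<not> contact F G \<ge> \<infinity>"
  proof
    assume "contact F G \<ge> \<infinity>"
    then obtain z where "z \<in> puiseux_roots N G" "puiseux_order N (z - x) \<ge> \<infinity>"
      unfolding contact_iff(1)[OF F G dvd(1) N x] by blast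
    then have "x \<in> puiseux_roots N G" by (auto simp: puiseux_order_def split: if_splits)
    then show False using monic_irreducible_eq_of_common_puiseux_root[OF F G N x] assms by blast
  qed
  ultimately show ?thesis by (cases "contact F G") auto
qed

section \<open>Points of the tree\<close>

lemma component_monic_irreducible: "g \<in> components f \<Longrightarrow> monic_irreducible g"
  by (simp add: components_def)

text \<open>Transitivity of the contact makes a class closed under contact at least
  \<open>M\<close>. Maximality then gives exact contact: a pair with larger contact K would give a
  point at level K dominating (M, P).\<close>

lemma Top_point:
  fixes f :: "'a::{alg_closed_field, field_char_0} fls poly"
  assumes "(M, P) \<in> Top f"
  shows "\<exists>m. M = ereal m" "P \<noteq> {}" "P \<subseteq> components f"
    and "\<And>F G. F \<in> P \<Longrightarrow> G \<in> components f \<Longrightarrow> contact F G \<ge> M \<Longrightarrow> G \<in> P"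
    and "\<And>F G. F \<in> P \<Longrightarrow> G \<in> P \<Longrightarrow> F \<noteq> G \<Longrightarrow> contact F G = M"
proof -
  have M: "M \<in> levels f" and P: "P \<in> level_components f M // level_rel f M"
    using assms by (auto simp: Top_def tree_points_def)
  note mi = component_monic_irreducible[of _ f]
  show "\<exists>m. M = ereal m"
    using M contact_real mi unfolding levels_def char_ratio_def by blast
  obtain p where p: "p \<in> level_components f M" "P = level_rel f M `` {p}"
    using P by (auto simp: quotient_def)
  have comp: "level_components f K \<subseteq> components f" for K by (auto simp: level_components_def)
  show sub: "P \<subseteq> components f" using p comp by (auto simp: level_rel_def)
  show "P \<noteq> {}" using p by (auto simp: level_rel_def)
  have in_comp: "F \<in> level_components f K"
    if "F \<in> components f" "G \<in> components f" "F \<noteq> G" "contact F G \<ge> K" for F G K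
    using that by (auto simp: level_components_def)
  have rel_p: "F = p \<or> contact p F \<ge> M" if "F \<in> P" for F
    using that p by (auto simp: level_rel_def)
  have pc: "p \<in> components f" using p comp by blast
  have closed: "G \<in> P" if FG: "F \<in> P" "G \<in> components f" "contact F G \<ge> M" for F G
  proof (cases "G = p")
    case False
    have "contact p G \<ge> M"
      using rel_p[OF FG(1)] FG contact_trans[of p F G] pc sub mi by blast
    moreover from this have "G \<in> level_components f M"
      using in_comp[of G p] contact_commute[of p G] pc FG(2) mi False by auto
    ultimately show ?thesis using p by (auto simp: level_rel_def)
  qed (use p in \<open>auto simp: level_rel_def\<close>)
  then show "\<And>F G. F \<in> P \<Longrightarrow> G \<in> components f \<Longrightarrow> contact F G \<ge> M \<Longrightarrow> G \<in> P" .
  show "contact F G = M" if FG: "F \<in> P" "G \<in> P" "F \<noteq> G" for F G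
  proof -
    have c: "F \<in> components f" "G \<in> components f" using FG sub by auto
    have ge: "contact F G \<ge> M"
      using rel_p[OF FG(1)] rel_p[OF FG(2)] FG(3) contact_trans[of F p G] contact_commute[of p F] c pc mi by metis
    define K where "K = contact F G"
    \<comment> \<open>The candidate for a dominating point is the class of \<open>F\<close> at the
      level \<open>K\<close> of its contact with \<open>G\<close>; maximality of (M, P) forces K =
      M.\<close>
    define S where "S = level_rel f K `` {F}"
    have "K \<in> levels f" using c FG(3) by (auto simp: levels_def K_def)
    moreover have "F \<in> level_components f K" using in_comp[of F G K] c FG(3) by (simp add: K_def)
    ultimately have "(K, S) \<in> tree_points f" by (auto simp: tree_points_def S_def quotient_def)
    moreover have "S \<subseteq> P"
    proof
      fix H assume "H \<in> S"
      then have "H \<in> components f" "F = H \<or> contact F H \<ge> K"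
        using comp by (auto simp: S_def level_rel_def)
      then show "H \<in> P" using closed[OF FG(1), of H] ge FG(1) unfolding K_def[symmetric] by auto
    qed
    ultimately have "(K, S) = (M, P)"
      using assms ge by (auto simp: Top_def dominates_def K_def)
    then show ?thesis by (simp add: K_def)
  qed
qed

section \<open>Critical points over a top point\<close>

lemma degree_Q_factor:
  fixes H :: "'a::field fls poly"
  assumes "H \<noteq> 0"
  shows "degree (Q_factor H M P) = (\<Sum>g\<in>{g \<in> components H. \<forall>F\<in>P. contact g F = M}. multiplicity g H * degree g)"
proof -
  have "g \<noteq> 0" if "g \<in> components H" for g
    using component_monic_irreducible[OF that] by (auto simp: monic_irreducible_def)
  then show ?thesis
    unfolding Q_factor_def by (subst degree_prod_eq_sum_degree) (auto simp: degree_power_eq)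
qed

lemma sum_card_swap:
  assumes "finite A" "finite B"
  shows "(\<Sum>y\<in>A. card {z \<in> B. R y z}) = (\<Sum>z\<in>B. card {y \<in> A. R y z})"
proof -
  have "(\<Sum>y\<in>A. card {z \<in> B. R y z}) = (\<Sum>y\<in>A. \<Sum>z\<in>B. if R y z then 1 else 0)"
    using assms by (simp add: sum.If_cases Int_def)
  also have "\<dots> = (\<Sum>z\<in>B. \<Sum>y\<in>A. if R y z then 1 else 0)" by (rule sum.swap)
  also have "\<dots> = (\<Sum>z\<in>B. card {y \<in> A. R y z})"
    using assms by (simp add: sum.If_cases Int_def)
  finally show ?thesis .
qed

text \<open>Double counting of pairs of a root y of \<open>F1\<close> and a root z of the
  derivative, with multiplicity, at order at least \<open>M\<close>. The ball around y contains
  \<open>sum b P\<close> roots of \<open>f\<close>, hence one less of the derivative; each z belongs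
  to a component in the product \<open>Q_factor\<close> and has \<open>b F1\<close> roots of
  \<open>F1\<close> near it.\<close>

lemma degree_Q_factor_pderiv:
  fixes f :: "'a::{alg_closed_field, field_char_0} fls poly"
  assumes f: "f \<noteq> 0" "squarefree f" and top: "(M, P) \<in> Top f" and F1: "F1 \<in> P"
    and b: "\<And>F N y. F \<in> P \<Longrightarrow> degree F dvd N \<Longrightarrow> N > 0 \<Longrightarrow> y \<in> puiseux_roots N F \<Longrightarrow>
        card (near N M F y) = b F"
    and apart: "\<And>F N y z. F \<in> P \<Longrightarrow> degree F dvd N \<Longrightarrow> N > 0 \<Longrightarrow> y \<in> puiseux_roots N F \<Longrightarrow>
        z \<in> puiseux_roots N F \<Longrightarrow> y \<noteq> z \<Longrightarrow> puiseux_order N (z - y) \<le> M"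
  shows "degree F1 * (sum b P - 1) = b F1 * degree (Q_factor (pderiv f) M P)"
proof -
  obtain m where m: "M = ereal m" using Top_point(1)[OF top] by blast
  note sub = Top_point(3)[OF top] and closed = Top_point(4)[OF top] and eqM = Top_point(5)[OF top]
  have fin: "finite (components f)" using f by (simp add: components_eq_prime_factors)
  have finP: "finite P" using sub fin by (rule finite_subset)
  have F1c: "F1 \<in> components f" using F1 sub by blast
  have "degree F1 > 0" using F1c component_monic_irreducible monic_irreducible_degree_pos by blast
  moreover have "degree F1 \<le> degree f" using F1c f by (auto simp: components_def intro: dvd_imp_degree_le)
  ultimately have f': "pderiv f \<noteq> 0" by (simp add: pderiv_eq_0_iff)
  have fin': "finite (components (pderiv f))" using f' by (simp add: components_eq_prime_factors)
  \<comment> \<open>The degrees of all components of \<open>f\<close> and its derivative divide (deg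
    f)!; the square makes products of two such degrees divide \<open>N\<close>, as
    \<open>contact_iff\<close> requires.\<close>
  define N where "N = fact (degree f) * (fact (degree f) :: nat)"
  have N: "N > 0" by (simp add: N_def)
  have dvd_fact: "degree g dvd fact (degree f)" if "g \<in> components f \<union> components (pderiv f)" for g
  proof (rule dvd_fact)
    have "monic_irreducible g" using that component_monic_irreducible by blast
    then show "1 \<le> degree g" using monic_irreducible_degree_pos[of g] by simp
    have "degree g \<le> degree f \<or> degree g \<le> degree (pderiv f)"
      using that f f' by (auto simp: components_def intro: dvd_imp_degree_le)
    then show "degree g \<le> degree f" using degree_pderiv[of f] by linarith
  qed
  have dvd2: "degree g * degree h dvd N"
    if "g \<in> components f \<union> components (pderiv f)" "h \<in> components f \<union> components (pderiv f)" for g h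
    unfolding N_def using that dvd_fact by (intro mult_dvd_mono) auto
  have dvd: "degree g dvd N" if "g \<in> components f \<union> components (pderiv f)" for g
    using dvd2[OF that that] by (rule dvd_mult_left)
  have mi: "monic_irreducible g" if "g \<in> components f \<union> components (pderiv f)" for g
    using that component_monic_irreducible by blast
  have finR: "finite (puiseux_roots N g)" if "g \<in> components f \<union> components (pderiv f)" for g
    using mi[OF that] N by (intro finite_puiseux_roots) (auto simp: monic_irreducible_def)
  have finN: "finite (near N K g y)" if "g \<in> components f \<union> components (pderiv f)" for g K y
    using finR[OF that] by (simp add: near_def)
  have mult: "multiplicity g f = 1" if "g \<in> components f" for g
    using that f squarefree_factorial_semiring'[of f] by (simp add: components_eq_prime_factors)
  have sym: "puiseux_order N (z - y) = puiseux_order N (y - z)" for y z :: "'a fls"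
    by (rule puiseux_order_minus)
  have near_y: "\<exists>y'\<in>puiseux_roots N F. puiseux_order N (y' - y) \<ge> M"
    if "F \<in> P" "y \<in> puiseux_roots N F1" for F y
  proof (cases "F = F1")
    case False
    have "contact F1 F \<ge> M" using eqM[OF F1 that(1)] False by auto
    then show ?thesis
      using contact_iff(1)[OF mi mi dvd2 N that(2), of F M] F1c that(1) sub by auto
  qed (use that in \<open>auto simp: puiseux_order_def intro!: bexI[of _ y]\<close>)
  have count_f: "(\<Sum>g\<in>components f. multiplicity g f * card (near N M g y)) = sum b P"
    if y: "y \<in> puiseux_roots N F1" for y
  proof -
    have "(\<Sum>g\<in>components f. multiplicity g f * card (near N M g y)) = (\<Sum>g\<in>components f. card (near N M g y))"
      using mult by simp
    also have "\<dots> = (\<Sum>g\<in>P. card (near N M g y))"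
    proof (rule sum.mono_neutral_right[OF fin sub], safe)
      fix g assume g: "g \<in> components f" "g \<notin> P"
      then have "\<not> contact F1 g \<ge> M" using closed[OF F1] by blast
      then have "near N M g y = {}"
        using contact_iff(1)[OF mi mi dvd2 N y, of g M] F1c g by (auto simp: near_def)
      then show "card (near N M g y) = 0" by simp
    qed
    also have "\<dots> = sum b P"
    proof (rule sum.cong[OF refl])
      fix F assume F: "F \<in> P"
      obtain y' where y': "y' \<in> puiseux_roots N F" "puiseux_order N (y' - y) \<ge> M"
        using near_y[OF F y] by blast
      show "card (near N M F y) = b F"
        using near_cong[OF N y'(2), of F] b[OF F _ N y'(1)] dvd F sub by auto
    qed
    finally show ?thesis .
  qed
  have bF1: "b F1 > 0"
  proof -
    obtain y where y: "y \<in> puiseux_roots N F1"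
      using puiseux_roots_nonempty[OF mi dvd N] F1c by blast
    then have "y \<in> near N M F1 y" by (simp add: near_def puiseux_order_def)
    then have "card (near N M F1 y) > 0" using finN[of F1] F1c by (auto simp: card_gt_0_iff)
    then show ?thesis using b[OF F1 _ N y] dvd F1c by simp
  qed
  have "b F1 \<le> sum b P" using member_le_sum[of F1 P b] F1 finP by simp
  then obtain d where d: "sum b P = Suc d" using bF1 by (cases "sum b P") auto
  have count_f': "(\<Sum>g\<in>components (pderiv f). multiplicity g (pderiv f) * card (near N M g y)) = d"
    if "y \<in> puiseux_roots N F1" for y
    using rolle_count[OF f' N dvd, of m y d] count_f[OF that] d m by simp
  have contact_crit: "contact g F = M"
    if g: "g \<in> components (pderiv f)" and z: "z \<in> near N M g y" and y: "y \<in> puiseux_roots N F1" and F: "F \<in> P"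
    for g z y F
  proof (rule antisym)
    have gc: "g \<in> components f \<union> components (pderiv f)" and Fc: "F \<in> components f \<union> components (pderiv f)"
      using g F sub by auto
    have zg: "z \<in> puiseux_roots N g" "puiseux_order N (z - y) \<ge> M" using z by (auto simp: near_def)
    obtain y' where y': "y' \<in> puiseux_roots N F" "puiseux_order N (y' - y) \<ge> M"
      using near_y[OF F y] by blast
    then have "puiseux_order N (y' - z) \<ge> M"
      using puiseux_order_trans[OF N y'(2), of z] zg(2) sym[of y z] by simp
    then show "contact g F \<ge> M"
      using contact_iff(1)[OF mi[OF gc] mi[OF Fc] dvd2[OF gc Fc] N zg(1)] y'(1) by blast
    show "contact g F \<le> M"
    proof (rule ccontr)
      assume "\<not> contact g F \<le> M"
      then obtain x where x: "x \<in> puiseux_roots N F" "puiseux_order N (x - z) > M"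
        using contact_iff(2)[OF mi[OF gc] mi[OF Fc] dvd2[OF gc Fc] N zg(1)] by (auto simp: not_le)
      \<comment> \<open>If the contact exceeded \<open>M\<close>, a smaller closed ball of order
        \<open>m'\<close> around the root \<open>x\<close> of \<open>F\<close> would still contain
        \<open>z\<close>. Since \<open>x\<close> is the only root of \<open>f\<close> in it,
        \<open>rolle_count\<close> leaves no room for a root of the derivative.\<close>
      then obtain m' where m': "M < ereal m'" "ereal m' < puiseux_order N (x - z)"
        using ereal_dense2[OF x(2)] by blast
      have only: "near N (ereal m') G x = (if G = F then {x} else {})" if G: "G \<in> components f" for G
      proof (cases "G = F")
        case True
        have "x' = x" if "x' \<in> near N (ereal m') F x" for x'
          using that apart[OF F _ N x(1), of x'] dvd[OF Fc] m'(1) by (fastforce simp: near_def)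
        moreover have "x \<in> near N (ereal m') F x" using x(1) by (simp add: near_def puiseux_order_def)
        ultimately show ?thesis using True by auto
      next
        case False
        have "near N (ereal m') G x = {}"
        proof (rule ccontr)
          assume "near N (ereal m') G x \<noteq> {}"
          then have "contact F G \<ge> ereal m'"
            using contact_iff(1)[OF mi[OF Fc] mi dvd2[OF Fc] N x(1), of G] G by (auto simp: near_def)
          then have "contact F G > M" using m'(1) by simp
          then show False using closed[OF F G] eqM[OF F _ False[symmetric]] by force
        qed
        then show ?thesis using False by simp
      qed
      have "(\<Sum>G\<in>components f. multiplicity G f * card (near N (ereal m') G x)) = (\<Sum>G\<in>components f. if G = F then 1 else 0)"
        using only mult by (intro sum.cong) auto
      also have "\<dots> = Suc 0" using fin F sub by auto
      finally have "(\<Sum>G\<in>components (pderiv f). multiplicity G (pderiv f) * card (near N (ereal m') G x)) = 0"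
        by (rule rolle_count[OF f' N, rotated]) (rule dvd)
      then have "multiplicity g (pderiv f) * card (near N (ereal m') g x) = 0"
        using fin' g by (simp only: sum_eq_0_iff)
      then have "near N (ereal m') g x = {}"
        using multiplicity_component_pos[OF f' g] finN[OF gc] by simp
      moreover have "z \<in> near N (ereal m') g x" using zg(1) m'(2) sym[of x z] by (simp add: near_def)
      ultimately show False by blast
    qed
  qed
  define S where "S = {g \<in> components (pderiv f). \<forall>F\<in>P. contact g F = M}"
  have S: "S \<subseteq> components (pderiv f)" by (auto simp: S_def)
  have R1: "card (puiseux_roots N F1) = degree F1"
    using puiseux_roots_conj(2)[OF mi N] puiseux_roots_nonempty[OF mi dvd N] F1c by blast
  \<comment> \<open>Each of the deg F1 roots of \<open>F1\<close> contributes \<open>d\<close>. Next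
    the sums are exchanged, and components outside \<open>S\<close> drop out by
    \<open>contact_crit\<close>.\<close>
  have "degree F1 * d = (\<Sum>y\<in>puiseux_roots N F1. \<Sum>g\<in>components (pderiv f). multiplicity g (pderiv f) * card (near N M g y))"
    using count_f' R1 by simp
  also have "\<dots> = (\<Sum>g\<in>components (pderiv f). multiplicity g (pderiv f) * (\<Sum>y\<in>puiseux_roots N F1. card (near N M g y)))"
    by (subst sum.swap) (simp add: sum_distrib_left)
  also have "\<dots> = (\<Sum>g\<in>S. multiplicity g (pderiv f) * (\<Sum>y\<in>puiseux_roots N F1. card (near N M g y)))"
  proof (rule sum.mono_neutral_right[OF fin' S], safe)
    fix g assume g: "g \<in> components (pderiv f)" "g \<notin> S"
    then have "near N M g y = {}" if "y \<in> puiseux_roots N F1" for y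
      using contact_crit[OF g(1) _ that] by (auto simp: S_def)
    then show "multiplicity g (pderiv f) * (\<Sum>y\<in>puiseux_roots N F1. card (near N M g y)) = 0" by simp
  qed
  also have "\<dots> = (\<Sum>g\<in>S. multiplicity g (pderiv f) * (degree g * b F1))"
  proof (rule sum.cong[OF refl], rule arg_cong2[where f = times, OF refl])
    fix g assume g: "g \<in> S"
    then have gc: "g \<in> components f \<union> components (pderiv f)" using S by blast
    have F1c': "F1 \<in> components f \<union> components (pderiv f)" using F1c by simp
    \<comment> \<open>The pairs are now counted from the side of the roots of \<open>g\<close>; by
      contact \<open>M\<close> each of these lies in a ball around a root of \<open>F1\<close>,
      which contains \<open>b F1\<close> roots of \<open>F1\<close>.\<close>
    have "(\<Sum>y\<in>puiseux_roots N F1. card (near N M g y)) =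
        (\<Sum>z\<in>puiseux_roots N g. card {y \<in> puiseux_roots N F1. puiseux_order N (z - y) \<ge> M})"
      unfolding near_def using finR[OF F1c'] finR[OF gc] by (rule sum_card_swap)
    also have "\<dots> = (\<Sum>z\<in>puiseux_roots N g. b F1)"
    proof (rule sum.cong[OF refl])
      fix z assume z: "z \<in> puiseux_roots N g"
      have "contact g F1 \<ge> M" using g F1 by (simp add: S_def)
      then obtain y where y: "y \<in> puiseux_roots N F1" "puiseux_order N (y - z) \<ge> M"
        using contact_iff(1)[OF mi[OF gc] mi[OF F1c'] dvd2[OF gc F1c'] N z] by blast
      have "{y \<in> puiseux_roots N F1. puiseux_order N (z - y) \<ge> M} = near N M F1 z"
        unfolding near_def sym[of z] ..
      then show "card {y \<in> puiseux_roots N F1. puiseux_order N (z - y) \<ge> M} = b F1"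
        using near_cong[OF N y(2), of F1] b[OF F1 dvd[OF F1c'] N y(1)] by simp
    qed
    also have "\<dots> = degree g * b F1"
      using puiseux_roots_conj(2)[OF mi[OF gc] N] puiseux_roots_nonempty[OF mi[OF gc] dvd[OF gc] N] by auto
    finally show "(\<Sum>y\<in>puiseux_roots N F1. card (near N M g y)) = degree g * b F1" .
  qed
  also have "\<dots> = b F1 * degree (Q_factor (pderiv f) M P)"
    unfolding degree_Q_factor[OF f'] S_def[symmetric] by (simp add: sum_distrib_left mult_ac)
  finally show ?thesis by (simp add: d)
qed

lemma card_near_of_gt_last_exponent:
  fixes F :: "'a::{alg_closed_field, field_char_0} fls poly"
  assumes F: "monic_irreducible F" and N: "degree F dvd N" "N > 0"
    and y: "y \<in> puiseux_roots N F" and M: "gt_last_exponent M F"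
  shows "card (near N M F y) = 1"
proof -
  have "near N M F y = {y}"
    using roots_apart_of_gt_last_exponent[OF F N y _ _ M] y
    by (fastforce simp: near_def puiseux_order_def[of _ 0])
  then show ?thesis by simp
qed

section \<open>From characteristic exponents to the three cases\<close>

text \<open>\<open>E\<close> separates the elements whose last exponent is \<open>M\<close> from
  those whose exponents all lie below \<open>M\<close>. The three cases of the theorem take it to be
  empty, all of the point, and all but one element.\<close>

lemma degree_Q_factor_pderiv_of_exponents:
  fixes f :: "'a::{alg_closed_field, field_char_0} fls poly"
  assumes f: "f \<noteq> 0" "squarefree f" and top: "(M, P) \<in> Top f" and F1: "F1 \<in> P"
    and E: "\<And>F. F \<in> P \<Longrightarrow> if F \<in> E then eq_last_exponent M F else gt_last_exponent M F"
  defines "b \<equiv> \<lambda>F. if F \<in> E then char_d F (char_h F) else 1"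
  shows "degree F1 * (sum b P - 1) = b F1 * degree (Q_factor (pderiv f) M P)"
proof (rule degree_Q_factor_pderiv[OF f top F1])
  fix F N y assume F: "F \<in> P" and N: "degree F dvd N" "N > 0" and y: "y \<in> puiseux_roots N F"
  have mi: "monic_irreducible F" using F Top_point(3)[OF top] component_monic_irreducible by blast
  show "card (near N M F y) = b F"
    using E[OF F] card_near_of_gt_last_exponent[OF mi N y] roots_apart_of_eq_last_exponent(2)[OF mi N y]
    by (auto simp: b_def near_def split: if_splits)
  show "puiseux_order N (z - y) \<le> M" if z: "z \<in> puiseux_roots N F" "y \<noteq> z" for z
    using E[OF F] roots_apart_of_gt_last_exponent[OF mi N y z] roots_apart_of_eq_last_exponent(1)[OF mi N y _ z]
    by (auto intro: less_imp_le split: if_splits)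
qed

text \<open>Proportionality at index h + 1, where both divisors are 1, gives equal degrees; at index
  h it then gives equal divisors.\<close>

lemma char_d_last_eq:
  fixes F G :: "'a::{alg_closed_field, field_char_0} fls poly"
  assumes F: "monic_irreducible F" and G: "monic_irreducible G" and FG: "equivalent_to F G"
  shows "char_d F (char_h F) = char_d G (char_h G)"
proof -
  have h: "char_h F = char_h G" and ratio: "\<And>k. 1 \<le> k \<Longrightarrow> k \<le> char_h G \<Longrightarrow> char_ratio F k = char_ratio G k"
    using FG by (auto simp: equivalent_to_def)
  have deg: "degree F = degree G"
    using char_d_proportional[OF F G ratio, of "char_h G"] char_d_h[OF F] char_d_h[OF G] h by simp
  show ?thesis
  proof (cases "char_h G")
    case (Suc k)
    then show ?thesis
      using char_d_proportional[OF F G ratio, of k] deg h degree_pos[OF G] by simp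
  qed (use h deg in simp)
qed

theorem theorem7p9:
  fixes f :: "'a::{alg_closed_field, field_char_0} fls poly"
    and M :: ereal
    and Fs :: "'a fls poly list"
  assumes "lead_coeff f = 1"
    and "squarefree f"
    and "(M, set Fs) \<in> Top f"
    and "distinct Fs"
    and "degree (hd Fs) = Max (degree ` set Fs)"
  shows
    "let F1 = hd Fs;
         r = real (length Fs);
         n = real (degree F1);
         h = char_h F1;
         degQ = real (degree (Q_factor (pderiv f) M (set Fs)))
     in (equivalent_seq Fs \<and> gt_last_exponent M F1 \<longrightarrow> degQ = (r - 1) * n) \<and>
        (equivalent_seq Fs \<and> eq_last_exponent M F1 \<longrightarrow>
           degQ = (r - 1) * n + (real (char_e F1 h) - 1) * (n / real (char_d F1 h))) \<and>
        (almost_equivalent_seq Fs \<longrightarrow> degQ = (r - 1) * n)"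
proof -
  define F1 where "F1 = hd Fs"
  define r where "r = length Fs"
  define n where "n = degree F1"
  define d where "d = char_d F1 (char_h F1)"
  define q where "q = degree (Q_factor (pderiv f) M (set Fs))"
  have f0: "f \<noteq> 0" using assms(1) by auto
  note main = degree_Q_factor_pderiv_of_exponents[OF f0 assms(2,3)]
  have "Fs \<noteq> []" using Top_point(2)[OF assms(3)] by simp
  then have F1: "F1 \<in> set Fs" and r: "r > 0" by (simp_all add: F1_def r_def)
  have mi: "monic_irreducible F" if "F \<in> set Fs" for F
    using that Top_point(3)[OF assms(3)] component_monic_irreducible by blast
  have card: "card (set Fs) = r" using assms(4) by (simp add: r_def distinct_card)
  have d: "d > 0" unfolding d_def by (rule char_d_pos[OF degree_pos[OF mi[OF F1]]])
  have exps: "char_h F = char_h F1 \<and> (char_h F1 \<noteq> 0 \<longrightarrow> char_ratio F (char_h F1) = char_ratio F1 (char_h F1))"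
    if "equivalent_to F F1" for F
    using that by (auto simp: equivalent_to_def)
  have 1: "real q = (real r - 1) * real n" if eq: "equivalent_seq Fs" and M: "gt_last_exponent M F1"
  proof -
    have "gt_last_exponent M F" if "F \<in> set Fs" for F
      using eq M exps[of F] that by (auto simp: equivalent_seq_def F1_def[symmetric] gt_last_exponent_def)
    \<comment> \<open>With \<open>E\<close> empty all weights are 1 and their sum is
      \<open>r\<close>.\<close>
    then have "n * (r - 1) = q"
      using main[OF F1, of "{}"] card by (simp add: n_def q_def)
    then show ?thesis using r by (auto simp: of_nat_diff mult.commute)
  qed
  have 2: "real q = (real r - 1) * real n + (real (char_e F1 (char_h F1)) - 1) * (real n / real d)"
    if eq: "equivalent_seq Fs" and M: "eq_last_exponent M F1"
  proof -
    have equiv: "equivalent_to F F1" if "F \<in> set Fs" for F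
      using eq that by (simp add: equivalent_seq_def F1_def)
    have "eq_last_exponent M F" if "F \<in> set Fs" for F
      using M exps[OF equiv[OF that]] by (auto simp: eq_last_exponent_def)
    moreover have "char_d F (char_h F) = d" if "F \<in> set Fs" for F
      unfolding d_def using char_d_last_eq[OF mi[OF that] mi[OF F1] equiv[OF that]] .
    \<comment> \<open>All r weights equal \<open>d\<close>. Division by \<open>d\<close> gives q = r
      n - n / d, which is the claimed value since e_h = d_h by d_(h+1) = 1.\<close>
    ultimately have "n * (r * d - 1) = d * q"
      using main[OF F1, of "set Fs"] card F1 by (simp add: n_def q_def)
    then have "real n * (real r * real d - 1) = real d * real q"
      using r d by (metis One_nat_def Suc_leI nat_0_less_mult_iff of_nat_1 of_nat_diff of_nat_mult)
    moreover have "char_e F1 (char_h F1) = d"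
      using char_d_h[OF mi[OF F1]] by (simp add: char_e_def d_def)
    ultimately show ?thesis using d by (simp add: field_simps)
  qed
  have 3: "real q = (real r - 1) * real n" if almost: "almost_equivalent_seq Fs"
  proof -
    obtain As G Bs where ABs: "length Fs > 1" "Fs = As @ G # Bs" "equivalent_seq (As @ Bs)"
      "\<And>F. F \<in> set (As @ Bs) \<Longrightarrow> almost_equivalent_to G F"
      using almost unfolding almost_equivalent_seq_def by blast
    have G: "G \<in> set Fs" and sub: "set (As @ Bs) \<subseteq> set Fs" and notin: "G \<notin> set (As @ Bs)"
      using ABs(2) assms(4) by auto
    \<comment> \<open>The first \<open>char_h G\<close> ratios agree, so deg F is \<open>d_h\<close>
      times deg G with \<open>d_h > 1\<close>. Hence the exceptional element \<open>G\<close> cannot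
      have maximal degree.\<close>
    have small: "degree G < degree F" if F: "F \<in> set (As @ Bs)" for F
    proof -
      have h: "char_h F = char_h G + 1"
        and ratio: "\<And>k. 1 \<le> k \<Longrightarrow> k \<le> char_h G \<Longrightarrow> char_ratio F k = char_ratio G k"
        using ABs(4)[OF F] by (auto simp: almost_equivalent_to_def)
      have miF: "monic_irreducible F" using F sub mi by blast
      have "char_d F (char_h F) * degree G = degree F"
        using char_d_proportional[OF miF mi[OF G] ratio] char_d_h[OF mi[OF G]] h by simp
      moreover have "char_d F (char_h F) > 1" by (rule char_d_gt_1[OF miF]) (simp_all add: h)
      moreover have "degree G > 0" by (rule degree_pos[OF mi[OF G]])
      ultimately show ?thesis using mult_less_mono1[of 1 "char_d F (char_h F)" "degree G"] by simp
    qed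
    \<comment> \<open>The head of the list has maximal degree, so it differs from \<open>G\<close>
      and is also the head of the equivalent subsequence.\<close>
    have "As \<noteq> []"
    proof
      assume "As = []"
      then have "F1 = G" and "Bs \<noteq> []" using ABs(1,2) by (auto simp: F1_def)
      then obtain F where F: "F \<in> set (As @ Bs)" by (cases Bs) auto
      then have "degree F \<le> Max (degree ` set Fs)" using sub by (intro Max_ge) auto
      then have "degree F \<le> degree G" using assms(5) \<open>F1 = G\<close> by (simp add: F1_def)
      with small[OF F] show False by simp
    qed
    then have hd: "hd (As @ Bs) = F1" using ABs(2) by (simp add: F1_def)
    have F1': "F1 \<in> set (As @ Bs)" using \<open>As \<noteq> []\<close> ABs(2) by (simp add: F1_def)
    then have "F1 \<noteq> G" using notin by blast
    have almost1: "almost_equivalent_to G F1" using ABs(4)[OF F1'] .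
    \<comment> \<open>The contact of \<open>G\<close> and \<open>F1\<close> is \<open>M\<close> by
      maximality of the point, and the last exponent of \<open>F1\<close> by almost
      equivalence.\<close>
    have M: "eq_last_exponent M F1"
      using almost1 Top_point(5)[OF assms(3) F1 G \<open>F1 \<noteq> G\<close>] by (simp add: almost_equivalent_to_def)
    have equiv: "equivalent_to F F1" if "F \<in> set (As @ Bs)" for F
      using ABs(3) that hd by (simp add: equivalent_seq_def)
    \<comment> \<open>The last exponent of \<open>G\<close> is the last but one of
      \<open>F1\<close>, which is less than \<open>M\<close>.\<close>
    have gtG: "gt_last_exponent M G"
    proof (cases "char_h G = 0")
      case False
      have "char_ratio G (char_h G) = char_ratio F1 (char_h G)" and "char_h F1 = char_h G + 1"
        using almost1 False by (auto simp: almost_equivalent_to_def)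
      then show ?thesis
        using char_ratio_less[OF mi[OF F1], of "char_h G" "char_h F1"] M False
        by (simp add: gt_last_exponent_def eq_last_exponent_def)
    qed (simp add: gt_last_exponent_def)
    have "eq_last_exponent M F" if "F \<in> set (As @ Bs)" for F
      using M exps[OF equiv[OF that]] by (auto simp: eq_last_exponent_def)
    then have E: "if F \<in> set (As @ Bs) then eq_last_exponent M F else gt_last_exponent M F"
      if "F \<in> set Fs" for F
      using that gtG ABs(2) by auto
    have Fs: "set Fs = insert G (set (As @ Bs))" using ABs(2) by auto
    define b where "b = (\<lambda>F. if F \<in> set (As @ Bs) then char_d F (char_h F) else 1)"
    have b: "b F = d" if "F \<in> set (As @ Bs)" for F
      using that char_d_last_eq[OF mi mi[OF F1] equiv[OF that]] sub by (auto simp: b_def d_def)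
    have "card (set (As @ Bs)) = r - 1"
      using ABs(2) assms(4) distinct_card[of "As @ Bs"] by (simp add: r_def)
    then have "sum b (set (As @ Bs)) = (r - 1) * d" using b by simp
    moreover have "sum b (set Fs) = b G + sum b (set (As @ Bs))"
      unfolding Fs using notin by (intro sum.insert) auto
    moreover have "b G = 1" using notin by (simp add: b_def)
    moreover have "n * (sum b (set Fs) - 1) = b F1 * q"
      unfolding n_def q_def b_def using E by (rule main[OF F1])
    \<comment> \<open>The weights sum to 1 + (r - 1) d; the single root contributed by
      \<open>G\<close> cancels the one lost by differentiation.\<close>
    ultimately have "n * ((r - 1) * d) = d * q" using b[OF F1'] by simp
    then have "q = n * (r - 1)" using d by simp
    then show ?thesis using r by (simp add: of_nat_diff mult.commute)
  qed
  show ?thesis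
    using 1 2 3 by (simp add: Let_def F1_def r_def n_def d_def q_def)
qed

end
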